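(* It is decidable whether an MLSL formula holds globally in an MLSL transition sequence. That is, there is an algorithm which, given a finite set of cars $\mathbb{I}$ with physical lengths $pl(C)$, a finite set of lanes $\mathbb{L}$, a deceleration constant $b_{max}$, an initial MLSL model $M=(TS,V,\nu)$, a timed word $\rho$ (such that $\rho(TS)$ is an admissible transition sequence) and an MLSL formula $\phi$, decides whether $\rho(M)\models_{seq} G\,\phi$, i.e. whether $\rho(M)@t\models\phi$ for every $t\in span(\rho)$.
   Context: Cars and snapshots. $\mathbb{I}$ is a finite set of cars, $\mathbb{L}=\{1,\dots,k\}$ a finite set of lanes. Each car $C$ has a physical length $pl(C)>0$, and $b_{max}>0$ is a fixed maximal deceleration. A traffic snapshot is $TS=(pos,len,spd,acc,res,clm)$ with $pos:\mathbb{I}\to\mathbb{R}$ (rear position), $len:\mathbb{I}\to\mathbb{R}_{>0}$ (length of the reservation including physical length, i.e. braking distance plus $pl$), $spd,acc:\mathbb{I}\to\mathbb{R}$, and $res,clm:\mathbb{I}\to\mathcal{P}(\mathbb{L})$ (reserved and claimed lanes). Transitions (for car $C$, $n\in\mathbb{L}$, $a\in\mathbb{R}$, $z\ge 0$; $f[C\mapsto x]$ denotes $f$ updated at $C$): $TS\xrightarrow{acc(C,a)}TS'$ iff $TS'$ is $TS$ with $acc[C\mapsto a]$; $TS\xrightarrow{c(C,n)}TS'$ iff $res(C)=\{n'\}$ for some $n'\in\{n-1,n+1\}$, $clm(C)=\emptyset$, and $TS'$ is $TS$ with $clm[C\mapsto\{n\}]$; $TS\xrightarrow{r(C)}TS'$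 iff $TS'$ is $TS$ with $res[C\mapsto res(C)\cup clm(C)]$ and $clm[C\mapsto\emptyset]$; $TS\xrightarrow{wd\,c(C)}TS'$ iff $TS'$ is $TS$ with $clm[C\mapsto\emptyset]$; $TS\xrightarrow{wd\,r(C,n)}TS'$ iff $n\in res(C)$ and $TS'$ is $TS$ with $res[C\mapsto\{n\}]$; $TS\xrightarrow{z}TS'$ iff $TS'$ is $TS$ with, for every car $C$, $pos'(C)=pos(C)+spd(C)z+\tfrac12 acc(C)z^2$, $spd'(C)=spd(C)+acc(C)z$, $len'(C)=\frac{(spd(C)+acc(C)z)^2}{b_{max}}+pl(C)$ (other components unchanged). Timed words. $\Sigma_C=\{c(C,n),r(C),wd\,c(C),wd\,r(C,n),acc(C,a)\mid n\in\mathbb{L},a\in\mathbb{R}\}$, $\Sigma=\bigcup_C\Sigma_C$. A timed word is $\rho=(\sigma,\tau)$ with $\sigma=\sigma_1\cdots\sigma_{n-1}\dagger$, $\sigma_i\in\Sigma$, where $\dagger\notin\Sigma$ is an end marker, and $\tau=\tau_1\cdots\tau_n$ weakly increasing in $\mathbb{R}_{\ge0}$; $span(\rho)=[0,\tau_n]$. The transition sequence $\rho(TS_1)$ is $TS_1\xrightarrow{\tau_1}TS_2\xrightarrow{\sigma_1}TS_3\xrightarrow{\tau_2-\tau_1}\cdots\xrightarrow{\sigma_{n-1}}TS_{2n-1}\xrightarrow{\tau_n-\tau_{n-1}}TS_{2n}\xrightarrow{0}TS_{2n}$; only timed words for which every transition exists are considered, and moreover each transition labelled $r(C)$, $wd\,c(C)$,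 $wd\,r(C,n)$ changes the snapshot. For $t\in span(\rho)$, let $i$ be the largest index with $\tau_i\le t$; the time-bounded prefix is $\rho_t=(\sigma_1,\tau_1)\cdots(\sigma_i,\tau_i)(\dagger,t)$ (an occurrence of $\dagger$ among $\sigma_1,\dots,\sigma_i$ acts as no change), and $\rho(TS)@t$ is the last snapshot of $\rho_t(TS)$. Views and models. A view is $V=(L,X,E)$ with $L=[l,n]$ an interval of lanes (empty if $l>n$), $X=[r,t]\subseteq\mathbb{R}$, owner $E\in\mathbb{I}$; $V^{L'}=(L',X,E)$, $V_{X'}=(L,X',E)$. With a set of car variables $CVar$ and special variable $ego$, a valuation $\nu:CVar\cup\{ego\}\to\mathbb{I}$ has $\nu(ego)=E$. A model is $M=(TS,V,\nu)$. The model at time $t$ is $\rho(M)@t=(TS',([l,n],[r+\Delta,t+\Delta],E),\nu)$ where $TS'=\rho(TS)@t$ and $\Delta=pos'(E)-pos(E)$ (view moves with its owner). MLSL syntax: $\phi::=\gamma=\gamma'\mid free\mid re(\gamma)\mid cl(\gamma)\mid \ell=q\mid\neg\phi\mid\phi\wedge\phi\mid\exists c.\,\phi\mid\phi\frown\phi\mid\begin{smallmatrix}\phi\\\phi\end{smallmatrix}$ with $\gamma,\gamma'\in CVar\cup\{ego\}$, $q\in\mathbb{Q}$, $c\in CVar$. Semantics for $M=(TS,([l,n],[r,t],E),\nu)$: $\gamma=\gamma'$ iff $\nu(\gamma)=\nu(\gamma')$; $free$ iff $l=n$, $r<t$, and for every car $C$, $l\notin res(C)\cup clm(C)$ or $[pos(C),pos(C)+len(C)]\cap(r,t)=\emptyset$;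 $re(\gamma)$ iff $l=n$, $r<t$, $l\in res(\nu(\gamma))$ and $[r,t]\subseteq[pos(\nu(\gamma)),pos(\nu(\gamma))+len(\nu(\gamma))]$; $cl(\gamma)$ likewise with $clm$; $\ell=q$ iff $t-r=q$; $\neg,\wedge$ as usual; $\exists c.\phi$ iff $(TS,V,\nu[c\mapsto C])\models\phi$ for some $C\in\mathbb{I}$; $\phi_1\frown\phi_2$ iff for some $s\in[r,t]$, $(TS,V_{[r,s]},\nu)\models\phi_1$ and $(TS,V_{[s,t]},\nu)\models\phi_2$; the vertical chop $\begin{smallmatrix}\phi_2\\\phi_1\end{smallmatrix}$ holds iff: if $l\le n$ then for some $m$ with $l-1\le m\le n$, $(TS,V^{[l,m]},\nu)\models\phi_1$ and $(TS,V^{[m+1,n]},\nu)\models\phi_2$; if $l>n$ then $M\models\phi_1$ and $M\models\phi_2$. Global satisfaction: $\rho(M)\models_{seq}G\,\phi$ iff $\rho(M)@t\models\phi$ for all $t\in span(\rho)$. *)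

theory Defs
  imports Complex_Main
begin

section \<open>Traffic snapshots and their transitions\<close>

text \<open>Cars are named by natural numbers; the finite set of cars \<open>I\<close> is a parameter. Lanes are
  integers, so that the empty intervals arising in the vertical chop need no special treatment.
  Snapshot components are total functions; only their values on \<open>I\<close> matter.\<close>

type_synonym car = nat
type_synonym lane = int

record snapshot =
  pos :: "car \<Rightarrow> real"
  len :: "car \<Rightarrow> real"
  spd :: "car \<Rightarrow> real"
  acc :: "car \<Rightarrow> real"
  res :: "car \<Rightarrow> lane set"
  clm :: "car \<Rightarrow> lane set"

datatype action =
    Claim car lane
  | Reserve car
  | WdClaim car
  | WdReserve car lane
  | Accel car real

datatype symbol = Act action | Dagger

type_synonym timed_word = "(symbol \<times> real) list"

definition lanes :: "nat \<Rightarrow> lane set" where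
  "lanes k = {1..int k}"

fun in_alphabet :: "car set \<Rightarrow> lane set \<Rightarrow> action \<Rightarrow> bool" where
  "in_alphabet I L (Claim C n) \<longleftrightarrow> C \<in> I \<and> n \<in> L"
| "in_alphabet I L (Reserve C) \<longleftrightarrow> C \<in> I"
| "in_alphabet I L (WdClaim C) \<longleftrightarrow> C \<in> I"
| "in_alphabet I L (WdReserve C n) \<longleftrightarrow> C \<in> I \<and> n \<in> L"
| "in_alphabet I L (Accel C a) \<longleftrightarrow> C \<in> I"

definition is_timed_word :: "car set \<Rightarrow> lane set \<Rightarrow> timed_word \<Rightarrow> bool" where
  "is_timed_word I L \<rho> \<longleftrightarrow>
     \<rho> \<noteq> [] \<and> fst (last \<rho>) = Dagger \<and>
     (\<forall>x\<in>set (butlast \<rho>). \<exists>a. fst x = Act a \<and> in_alphabet I L a) \<and>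
     sorted (map snd \<rho>) \<and> (\<forall>x\<in>set \<rho>. 0 \<le> snd x)"

definition word_span :: "timed_word \<Rightarrow> real set" where
  "word_span \<rho> = {0..snd (last \<rho>)}"

definition prefix_at :: "timed_word \<Rightarrow> real \<Rightarrow> timed_word" where
  "prefix_at \<rho> t = takeWhile (\<lambda>x. snd x \<le> t) \<rho> @ [(Dagger, t)]"

fun action_trans :: "snapshot \<Rightarrow> action \<Rightarrow> snapshot \<Rightarrow> bool" where
  "action_trans TS (Accel C a) TS' \<longleftrightarrow> TS' = TS\<lparr>acc := (acc TS)(C := a)\<rparr>"
| "action_trans TS (Claim C n) TS' \<longleftrightarrow>
     (\<exists>n'\<in>{n - 1, n + 1}. res TS C = {n'}) \<and> clm TS C = {} \<and>
     TS' = TS\<lparr>clm := (clm TS)(C := {n})\<rparr>"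
| "action_trans TS (Reserve C) TS' \<longleftrightarrow>
     TS' = TS\<lparr>res := (res TS)(C := res TS C \<union> clm TS C), clm := (clm TS)(C := {})\<rparr>"
| "action_trans TS (WdClaim C) TS' \<longleftrightarrow> TS' = TS\<lparr>clm := (clm TS)(C := {})\<rparr>"
| "action_trans TS (WdReserve C n) TS' \<longleftrightarrow>
     n \<in> res TS C \<and> TS' = TS\<lparr>res := (res TS)(C := {n})\<rparr>"

definition time_trans ::
    "(car \<Rightarrow> real) \<Rightarrow> real \<Rightarrow> snapshot \<Rightarrow> real \<Rightarrow> snapshot \<Rightarrow> bool" where
  "time_trans pl bmax TS z TS' \<longleftrightarrow> 0 \<le> z \<and>
     TS' = TS\<lparr>pos := (\<lambda>C. pos TS C + spd TS C * z + 1/2 * acc TS C * z^2),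
              spd := (\<lambda>C. spd TS C + acc TS C * z),
              len := (\<lambda>C. (spd TS C + acc TS C * z)^2 / bmax + pl C)\<rparr>"

fun must_change :: "action \<Rightarrow> bool" where
  "must_change (Claim C n) = False"
| "must_change (Reserve C) = True"
| "must_change (WdClaim C) = True"
| "must_change (WdReserve C n) = True"
| "must_change (Accel C a) = False"

fun symbol_trans :: "snapshot \<Rightarrow> symbol \<Rightarrow> snapshot \<Rightarrow> bool" where
  "symbol_trans TS Dagger TS' \<longleftrightarrow> TS' = TS"
| "symbol_trans TS (Act a) TS' \<longleftrightarrow>
     action_trans TS a TS' \<and> (must_change a \<longrightarrow> TS' \<noteq> TS)"

text \<open>\<open>run pl bmax \<tau> TS \<rho> TS'\<close>: the transition sequence of \<open>\<rho>\<close> from \<open>TS\<close>, entered at time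
  \<open>\<tau>\<close>, exists and its last snapshot is \<open>TS'\<close>. The final \<open>\<dagger>\<close> changes nothing, like the closing
  transition with delay 0.\<close>

inductive run ::
    "(car \<Rightarrow> real) \<Rightarrow> real \<Rightarrow> real \<Rightarrow> snapshot \<Rightarrow> timed_word \<Rightarrow> snapshot \<Rightarrow> bool"
  for pl :: "car \<Rightarrow> real" and bmax :: real where
  run_Nil: "run pl bmax \<tau> TS [] TS"
| run_Cons: "time_trans pl bmax TS (\<tau>' - \<tau>) TS1 \<Longrightarrow> symbol_trans TS1 \<sigma> TS2 \<Longrightarrow>
     run pl bmax \<tau>' TS2 \<rho> TS' \<Longrightarrow> run pl bmax \<tau> TS ((\<sigma>, \<tau>') # \<rho>) TS'"

definition snapshot_at ::
    "(car \<Rightarrow> real) \<Rightarrow> real \<Rightarrow> timed_word \<Rightarrow> snapshot \<Rightarrow> real \<Rightarrow> snapshot" where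
  "snapshot_at pl bmax \<rho> TS t = (THE TS'. run pl bmax 0 TS (prefix_at \<rho> t) TS')"


section \<open>Views, models and MLSL\<close>

record view =
  lane_lo :: lane
  lane_hi :: lane
  ext_lo :: real
  ext_hi :: real
  owner :: car

datatype cvar = Ego | CVar nat

type_synonym valuation = "cvar \<Rightarrow> car"
type_synonym model = "snapshot \<times> view \<times> valuation"

text \<open>\<open>VChop \<phi>\<^sub>2 \<phi>\<^sub>1\<close> has \<open>\<phi>\<^sub>2\<close> on the upper and \<open>\<phi>\<^sub>1\<close> on the lower lanes; \<open>Ex c \<phi>\<close> quantifies
  over \<open>CVar c\<close>, so \<open>Ego\<close> is never bound.\<close>

datatype mlsl =
    Same cvar cvar
  | Free
  | Re cvar
  | Cl cvar
  | LenEq rat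
  | Neg mlsl
  | Conj mlsl mlsl
  | Ex nat mlsl
  | HChop mlsl mlsl
  | VChop mlsl mlsl

fun sat :: "car set \<Rightarrow> model \<Rightarrow> mlsl \<Rightarrow> bool" where
  "sat I (TS, V, \<nu>) (Same c d) \<longleftrightarrow> \<nu> c = \<nu> d"
| "sat I (TS, V, \<nu>) Free \<longleftrightarrow> lane_lo V = lane_hi V \<and> ext_lo V < ext_hi V \<and>
     (\<forall>C\<in>I. lane_lo V \<notin> res TS C \<union> clm TS C \<or>
        {pos TS C..pos TS C + len TS C} \<inter> {ext_lo V<..<ext_hi V} = {})"
| "sat I (TS, V, \<nu>) (Re c) \<longleftrightarrow> lane_lo V = lane_hi V \<and> ext_lo V < ext_hi V \<and>
     lane_lo V \<in> res TS (\<nu> c) \<and>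
     {ext_lo V..ext_hi V} \<subseteq> {pos TS (\<nu> c)..pos TS (\<nu> c) + len TS (\<nu> c)}"
| "sat I (TS, V, \<nu>) (Cl c) \<longleftrightarrow> lane_lo V = lane_hi V \<and> ext_lo V < ext_hi V \<and>
     lane_lo V \<in> clm TS (\<nu> c) \<and>
     {ext_lo V..ext_hi V} \<subseteq> {pos TS (\<nu> c)..pos TS (\<nu> c) + len TS (\<nu> c)}"
| "sat I (TS, V, \<nu>) (LenEq q) \<longleftrightarrow> ext_hi V - ext_lo V = of_rat q"
| "sat I (TS, V, \<nu>) (Neg \<phi>) \<longleftrightarrow> \<not> sat I (TS, V, \<nu>) \<phi>"
| "sat I (TS, V, \<nu>) (Conj \<phi> \<psi>) \<longleftrightarrow> sat I (TS, V, \<nu>) \<phi> \<and> sat I (TS, V, \<nu>) \<psi>"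
| "sat I (TS, V, \<nu>) (Ex c \<phi>) \<longleftrightarrow> (\<exists>C\<in>I. sat I (TS, V, \<nu>(CVar c := C)) \<phi>)"
| "sat I (TS, V, \<nu>) (HChop \<phi>\<^sub>1 \<phi>\<^sub>2) \<longleftrightarrow>
     (\<exists>s\<in>{ext_lo V..ext_hi V}.
        sat I (TS, V\<lparr>ext_hi := s\<rparr>, \<nu>) \<phi>\<^sub>1 \<and> sat I (TS, V\<lparr>ext_lo := s\<rparr>, \<nu>) \<phi>\<^sub>2)"
| "sat I (TS, V, \<nu>) (VChop \<phi>\<^sub>2 \<phi>\<^sub>1) \<longleftrightarrow>
     (if lane_lo V \<le> lane_hi V
      then \<exists>m\<in>{lane_lo V - 1..lane_hi V}.
             sat I (TS, V\<lparr>lane_hi := m\<rparr>, \<nu>) \<phi>\<^sub>1 \<and> sat I (TS, V\<lparr>lane_lo := m + 1\<rparr>, \<nu>) \<phi>\<^sub>2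
      else sat I (TS, V, \<nu>) \<phi>\<^sub>1 \<and> sat I (TS, V, \<nu>) \<phi>\<^sub>2)"

fun model_at :: "(car \<Rightarrow> real) \<Rightarrow> real \<Rightarrow> timed_word \<Rightarrow> model \<Rightarrow> real \<Rightarrow> model" where
  "model_at pl bmax \<rho> (TS, V, \<nu>) t =
     (let TS' = snapshot_at pl bmax \<rho> TS t;
          \<Delta> = pos TS' (owner V) - pos TS (owner V)
      in (TS', V\<lparr>ext_lo := ext_lo V + \<Delta>, ext_hi := ext_hi V + \<Delta>\<rparr>, \<nu>))"

definition globally ::
    "car set \<Rightarrow> (car \<Rightarrow> real) \<Rightarrow> real \<Rightarrow> timed_word \<Rightarrow> model \<Rightarrow> mlsl \<Rightarrow> bool" where
  "globally I pl bmax \<rho> M \<phi> \<longleftrightarrow>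
     (\<forall>t\<in>word_span \<rho>. sat I (model_at pl bmax \<rho> M t) \<phi>)"


section \<open>Problem instances\<close>

record problem =
  cars :: "car set"
  lane_count :: nat
  plen :: "car \<Rightarrow> real"
  bmax :: real
  init_snapshot :: snapshot
  init_view :: view
  valuation :: valuation
  tword :: timed_word
  formula :: mlsl

definition is_snapshot :: "car set \<Rightarrow> lane set \<Rightarrow> snapshot \<Rightarrow> bool" where
  "is_snapshot I L TS \<longleftrightarrow> (\<forall>C\<in>I. 0 < len TS C \<and> res TS C \<subseteq> L \<and> clm TS C \<subseteq> L)"

definition is_view :: "car set \<Rightarrow> lane set \<Rightarrow> view \<Rightarrow> bool" where
  "is_view I L V \<longleftrightarrow> {lane_lo V..lane_hi V} \<subseteq> L \<and> owner V \<in> I"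

definition is_valuation :: "car set \<Rightarrow> view \<Rightarrow> valuation \<Rightarrow> bool" where
  "is_valuation I V \<nu> \<longleftrightarrow> range \<nu> \<subseteq> I \<and> \<nu> Ego = owner V"

definition admissible :: "problem \<Rightarrow> bool" where
  "admissible p \<longleftrightarrow>
     (let I = cars p; L = lanes (lane_count p) in
      finite I \<and> (\<forall>C\<in>I. 0 < plen p C) \<and> 0 < bmax p \<and>
      is_snapshot I L (init_snapshot p) \<and> is_view I L (init_view p) \<and>
      is_valuation I (init_view p) (valuation p) \<and>
      is_timed_word I L (tword p) \<and>
      (\<exists>TS'. run (plen p) (bmax p) 0 (init_snapshot p) (tword p) TS'))"

definition holds_globally :: "problem \<Rightarrow> bool" where
  "holds_globally p \<longleftrightarrow>
     globally (cars p) (plen p) (bmax p) (tword p)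
       (init_snapshot p, init_view p, valuation p) (formula p)"


section \<open>Algorithms\<close>

text \<open>The inputs contain real numbers, so algorithms are programs of a first-order functional
  language over binary trees whose leaves may carry numbers, with exact field arithmetic and
  comparison as basic operations (a real RAM in the sense of Blum, Shub and Smale). The only
  numeric constants in programs are integers, and there is no rounding operation. The number type
  is a parameter of the semantics: over \<^typ>\<open>rat\<close> all data are finite objects with computable basic
  operations, so the language defines exactly the Turing-computable functions.\<close>

datatype 'a data = Leaf | Atom 'a | Node "'a data" "'a data"

datatype arith = Add | Sub | Mul | Div | Less

datatype expr =
    Var nat
  | MkLeaf
  | IntConst int
  | MkNode expr expr
  | Fst expr
  | Snd expr
  | IsAtom expr
  | IsNode expr
  | Arith arith expr expr
  | Cond expr expr expr
  | Call nat "expr list"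

text \<open>A program lists the bodies of its procedures; \<open>Var i\<close> is the \<open>i\<close>-th argument of the
  procedure being executed.\<close>

type_synonym program = "expr list"

definition truth :: "bool \<Rightarrow> 'a::linordered_field data" where
  "truth b = Atom (if b then 1 else 0)"

fun arith_op :: "arith \<Rightarrow> 'a::linordered_field \<Rightarrow> 'a \<Rightarrow> 'a" where
  "arith_op Add x y = x + y"
| "arith_op Sub x y = x - y"
| "arith_op Mul x y = x * y"
| "arith_op Div x y = x / y"
| "arith_op Less x y = (if x < y then 1 else 0)"

inductive evaluates ::
      "program \<Rightarrow> 'a::linordered_field data list \<Rightarrow> expr \<Rightarrow> 'a data \<Rightarrow> bool"
  and evaluates_list ::
      "program \<Rightarrow> 'a::linordered_field data list \<Rightarrow> expr list \<Rightarrow> 'a data list \<Rightarrow> bool"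
  for P :: program where
  ev_Var: "i < length env \<Longrightarrow> evaluates P env (Var i) (env ! i)"
| ev_MkLeaf: "evaluates P env MkLeaf Leaf"
| ev_IntConst: "evaluates P env (IntConst k) (Atom (of_int k))"
| ev_MkNode: "evaluates P env e x \<Longrightarrow> evaluates P env e' y \<Longrightarrow>
     evaluates P env (MkNode e e') (Node x y)"
| ev_Fst: "evaluates P env e (Node x y) \<Longrightarrow> evaluates P env (Fst e) x"
| ev_Snd: "evaluates P env e (Node x y) \<Longrightarrow> evaluates P env (Snd e) y"
| ev_IsAtom: "evaluates P env e x \<Longrightarrow>
     evaluates P env (IsAtom e) (truth (\<exists>r. x = Atom r))"
| ev_IsNode: "evaluates P env e x \<Longrightarrow>
     evaluates P env (IsNode e) (truth (\<exists>y z. x = Node y z))"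
| ev_Arith: "evaluates P env e (Atom r) \<Longrightarrow> evaluates P env e' (Atom r') \<Longrightarrow>
     evaluates P env (Arith f e e') (Atom (arith_op f r r'))"
| ev_Cond_true: "evaluates P env c (Atom r) \<Longrightarrow> r \<noteq> 0 \<Longrightarrow> evaluates P env e x \<Longrightarrow>
     evaluates P env (Cond c e e') x"
| ev_Cond_false: "evaluates P env c (Atom r) \<Longrightarrow> r = 0 \<Longrightarrow> evaluates P env e' x \<Longrightarrow>
     evaluates P env (Cond c e e') x"
| ev_Call: "evaluates_list P env es xs \<Longrightarrow> f < length P \<Longrightarrow> evaluates P xs (P ! f) x \<Longrightarrow>
     evaluates P env (Call f es) x"
| ev_Nil: "evaluates_list P env [] []"
| ev_Cons: "evaluates P env e x \<Longrightarrow> evaluates_list P env es xs \<Longrightarrow>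
     evaluates_list P env (e # es) (x # xs)"

inductive_cases evaluates_VarE: "evaluates P env (Var i) x"
inductive_cases evaluates_MkLeafE: "evaluates P env MkLeaf x"
inductive_cases evaluates_IntConstE: "evaluates P env (IntConst k) x"
inductive_cases evaluates_MkNodeE: "evaluates P env (MkNode e e') x"
inductive_cases evaluates_FstE: "evaluates P env (Fst e) x"
inductive_cases evaluates_SndE: "evaluates P env (Snd e) x"
inductive_cases evaluates_IsAtomE: "evaluates P env (IsAtom e) x"
inductive_cases evaluates_IsNodeE: "evaluates P env (IsNode e) x"
inductive_cases evaluates_ArithE: "evaluates P env (Arith f e e') x"
inductive_cases evaluates_CondE: "evaluates P env (Cond c e e') x"
inductive_cases evaluates_CallE: "evaluates P env (Call f es) x"
inductive_cases evaluates_list_NilE: "evaluates_list P env [] xs"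
inductive_cases evaluates_list_ConsE: "evaluates_list P env (e # es) xs"

lemma evaluates_deterministic:
  "evaluates P env e x \<Longrightarrow> evaluates P env e y \<Longrightarrow> x = y"
  "evaluates_list P env es xs \<Longrightarrow> evaluates_list P env es ys \<Longrightarrow> xs = ys"
proof (induction arbitrary: y and ys rule: evaluates_evaluates_list.inducts)
  case (ev_Cond_true env c r e x e')
  from ev_Cond_true.prems show ?case
    using ev_Cond_true.IH ev_Cond_true.hyps by (elim evaluates_CondE) blast+
next
  case (ev_Cond_false env c r e' x e)
  from ev_Cond_false.prems show ?case
    using ev_Cond_false.IH ev_Cond_false.hyps by (elim evaluates_CondE) blast+
qed (blast elim: evaluates_VarE evaluates_MkLeafE evaluates_IntConstE evaluates_MkNodeE
       evaluates_FstE evaluates_SndE evaluates_IsAtomE evaluates_IsNodeE evaluates_ArithE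
       evaluates_CallE evaluates_list_NilE evaluates_list_ConsE)+

text \<open>Procedure 0 is the entry point.\<close>

definition computes :: "program \<Rightarrow> 'a::linordered_field data \<Rightarrow> 'a data \<Rightarrow> bool" where
  "computes P x y \<longleftrightarrow> evaluates P [x] (Call 0 [Var 0]) y"

text \<open>A single program must answer correctly on every instance in \<open>D\<close>. In addition, on instances
  whose numbers are all rational it must do so when executed over the rationals, that is, as an
  ordinary discrete algorithm.\<close>

definition decidable_on :: "'i set \<Rightarrow> ('i \<Rightarrow> real data) \<Rightarrow> ('i \<Rightarrow> bool) \<Rightarrow> bool" where
  "decidable_on D enc Q \<longleftrightarrow>
     (\<exists>P :: program. \<forall>i\<in>D.
        computes P (enc i) (truth (Q i)) \<and>
        (\<forall>x :: rat data. map_data of_rat x = enc i \<longrightarrow> computes P x (truth (Q i))))"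


section \<open>Encoding of problem instances\<close>

definition list_data :: "'a data list \<Rightarrow> 'a data" where
  "list_data xs = foldr Node xs Leaf"

definition nat_data :: "nat \<Rightarrow> real data" where
  "nat_data n = Atom (of_nat n)"

definition int_data :: "int \<Rightarrow> real data" where
  "int_data n = Atom (of_int n)"

definition tagged :: "nat \<Rightarrow> real data list \<Rightarrow> real data" where
  "tagged n xs = Node (nat_data n) (list_data xs)"

definition lanes_data :: "lane set \<Rightarrow> real data" where
  "lanes_data S = list_data (map int_data (sorted_list_of_set S))"

fun symbol_data :: "symbol \<Rightarrow> real data" where
  "symbol_data Dagger = tagged 0 []"
| "symbol_data (Act (Claim C n)) = tagged 1 [nat_data C, int_data n]"
| "symbol_data (Act (Reserve C)) = tagged 2 [nat_data C]"
| "symbol_data (Act (WdClaim C)) = tagged 3 [nat_data C]"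
| "symbol_data (Act (WdReserve C n)) = tagged 4 [nat_data C, int_data n]"
| "symbol_data (Act (Accel C a)) = tagged 5 [nat_data C, Atom a]"

definition word_data :: "timed_word \<Rightarrow> real data" where
  "word_data \<rho> = list_data (map (\<lambda>(\<sigma>, \<tau>). Node (symbol_data \<sigma>) (Atom \<tau>)) \<rho>)"

fun cvar_data :: "cvar \<Rightarrow> real data" where
  "cvar_data Ego = nat_data 0"
| "cvar_data (CVar i) = nat_data (Suc i)"

fun mlsl_data :: "mlsl \<Rightarrow> real data" where
  "mlsl_data (Same c d) = tagged 0 [cvar_data c, cvar_data d]"
| "mlsl_data Free = tagged 1 []"
| "mlsl_data (Re c) = tagged 2 [cvar_data c]"
| "mlsl_data (Cl c) = tagged 3 [cvar_data c]"
| "mlsl_data (LenEq q) = tagged 4 [Atom (of_rat q)]"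
| "mlsl_data (Neg \<phi>) = tagged 5 [mlsl_data \<phi>]"
| "mlsl_data (Conj \<phi> \<psi>) = tagged 6 [mlsl_data \<phi>, mlsl_data \<psi>]"
| "mlsl_data (Ex c \<phi>) = tagged 7 [cvar_data (CVar c), mlsl_data \<phi>]"
| "mlsl_data (HChop \<phi>\<^sub>1 \<phi>\<^sub>2) = tagged 8 [mlsl_data \<phi>\<^sub>1, mlsl_data \<phi>\<^sub>2]"
| "mlsl_data (VChop \<phi>\<^sub>2 \<phi>\<^sub>1) = tagged 9 [mlsl_data \<phi>\<^sub>2, mlsl_data \<phi>\<^sub>1]"

fun mlsl_vars :: "mlsl \<Rightarrow> cvar list" where
  "mlsl_vars (Same c d) = [c, d]"
| "mlsl_vars Free = []"
| "mlsl_vars (Re c) = [c]"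
| "mlsl_vars (Cl c) = [c]"
| "mlsl_vars (LenEq q) = []"
| "mlsl_vars (Neg \<phi>) = mlsl_vars \<phi>"
| "mlsl_vars (Conj \<phi> \<psi>) = mlsl_vars \<phi> @ mlsl_vars \<psi>"
| "mlsl_vars (Ex c \<phi>) = CVar c # mlsl_vars \<phi>"
| "mlsl_vars (HChop \<phi>\<^sub>1 \<phi>\<^sub>2) = mlsl_vars \<phi>\<^sub>1 @ mlsl_vars \<phi>\<^sub>2"
| "mlsl_vars (VChop \<phi>\<^sub>2 \<phi>\<^sub>1) = mlsl_vars \<phi>\<^sub>2 @ mlsl_vars \<phi>\<^sub>1"

text \<open>The valuation has infinite domain; it is given by its values at the variables occurring in
  the formula.\<close>

definition valuation_data :: "cvar list \<Rightarrow> valuation \<Rightarrow> real data" where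
  "valuation_data xs \<nu> = list_data (map (\<lambda>x. Node (cvar_data x) (nat_data (\<nu> x))) xs)"

definition view_data :: "view \<Rightarrow> real data" where
  "view_data V = list_data [int_data (lane_lo V), int_data (lane_hi V),
     Atom (ext_lo V), Atom (ext_hi V), nat_data (owner V)]"

definition cars_data :: "car set \<Rightarrow> (car \<Rightarrow> real) \<Rightarrow> snapshot \<Rightarrow> real data" where
  "cars_data I pl TS = list_data (map (\<lambda>C. list_data [nat_data C, Atom (pl C),
     Atom (pos TS C), Atom (len TS C), Atom (spd TS C), Atom (acc TS C),
     lanes_data (res TS C), lanes_data (clm TS C)]) (sorted_list_of_set I))"

definition problem_data :: "problem \<Rightarrow> real data" where
  "problem_data p = list_data
     [cars_data (cars p) (plen p) (init_snapshot p), nat_data (lane_count p), Atom (bmax p),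
      view_data (init_view p), valuation_data (mlsl_vars (formula p)) (valuation p),
      word_data (tword p), mlsl_data (formula p)]"

end

(*
  Within one segment between two events all car ends and the view borders are quadratic polynomials
  in the elapsed time z. At a fixed z, the truth of an MLSL formula on an interval depends only on how
  the interval borders compare with car ends shifted by finitely many offsets, so a chop point may
  be sought among the midpoints of pairs of such shifted ends. This turns the formula into a Boolean
  combination of sign conditions on quadratics in z. Such a combination holds throughout [0, b) iff
  it holds at and immediately to the right of 0 and of every root of an occurring quadratic in (0, b).
  A root is x + e sqrt D, where the sign of a quadratic can be found by field arithmetic and
  comparisons alone, so the procedure runs on a real RAM without square roots. Running it over the
  rationals gives the same answer because the embedding into the reals commutes with every step.
*)
theory Submission
  imports Defs
begin

section \<open>Executing programs\<close>

text \<open>The degree stays two for three reasons: a reservation contains the square of a speed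
  that is linear in z, the view keeps a fixed distance from its owner, and a candidate chop point is
  half a sum of two ends and constants. Nested chops therefore never leave the quadratics, and a
  root needs only one square root.

  The obstacle is the length constraint. Without it only the order of the ends would matter; with it
  a chop point also interacts with ends at a given distance. The invariant is the type of an
  interval (\<open>same_type\<close>) with respect to a finite set D of offsets. In a back-and-forth
  argument, matching a chop point requires comparing an end shifted by d with an end shifted by e,
  that is, two ends at offset e - d. As D is kept symmetric, such differences are sums, and so a
  horizontal chop collects all sums of two offsets of its parts.

  One list of candidates serves for every z. Their order changes with z, but at each z some
  candidate splits the interval into parts of the same types as a given chop point does.\<close>

lemma of_rat_arith_op:
  "(of_rat (arith_op f r s) :: real) = arith_op f (of_rat r) (of_rat s)"
  by (cases f) (auto simp: of_rat_add of_rat_diff of_rat_mult of_rat_divide of_rat_less)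

lemma map_data_of_rat_truth [simp]: "map_data (of_rat :: rat \<Rightarrow> real) (truth b) = truth b"
  by (simp add: truth_def)

lemma map_data_eq_AtomD: "map_data f x = Atom r \<Longrightarrow> \<exists>q. x = Atom q \<and> r = f q"
  by (cases x) auto

lemma map_data_eq_NodeD:
  "map_data f x = Node u v \<Longrightarrow> \<exists>u' v'. x = Node u' v' \<and> u = map_data f u' \<and> v = map_data f v'"
  by (cases x) auto

text \<open>Integer constants embed, and the field operations (with division by zero yielding zero)
  and the comparison commute with \<open>of_rat\<close>. Hence no irrational number can arise from
  embedded data, and the derivation over the reals can be replayed over the rationals; in particular
  its termination carries over.\<close>

lemma evaluates_over_rat:
  fixes P :: program
  shows "evaluates P renv e y \<Longrightarrow> renv = map (map_data (of_rat :: rat \<Rightarrow> real)) env \<Longrightarrow>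
      \<exists>y'. evaluates P env e y' \<and> y = map_data of_rat y'"
    and "evaluates_list P renv es ys \<Longrightarrow> renv = map (map_data (of_rat :: rat \<Rightarrow> real)) env \<Longrightarrow>
      \<exists>ys'. evaluates_list P env es ys' \<and> ys = map (map_data of_rat) ys'"
proof (induction arbitrary: env and env rule: evaluates_evaluates_list.inducts)
  case (ev_Var i renv)
  then show ?case by (auto intro: evaluates_evaluates_list.ev_Var)
next
  case (ev_IntConst renv k)
  then show ?case
    by (intro exI[of _ "Atom (of_int k)"]) (auto intro: evaluates_evaluates_list.ev_IntConst)
next
  case (ev_Fst renv e x y)
  from ev_Fst.IH(2)[OF ev_Fst.prems] show ?case
    by (metis map_data_eq_NodeD evaluates_evaluates_list.ev_Fst)
next
  case (ev_Snd renv e x y)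
  from ev_Snd.IH(2)[OF ev_Snd.prems] show ?case
    by (metis map_data_eq_NodeD evaluates_evaluates_list.ev_Snd)
next
  case (ev_IsAtom renv e x)
  then obtain x' where x': "evaluates P env e x'" "x = map_data of_rat x'" by blast
  have "(\<exists>r. x = Atom r) = (\<exists>r. x' = Atom r)"
    unfolding x'(2) by (cases x') auto
  then have "truth (\<exists>r. x = Atom r) = map_data (of_rat :: rat \<Rightarrow> real) (truth (\<exists>r. x' = Atom r))"
    by simp
  with evaluates_evaluates_list.ev_IsAtom[OF x'(1)] show ?case by blast
next
  case (ev_IsNode renv e x)
  then obtain x' where x': "evaluates P env e x'" "x = map_data of_rat x'" by blast
  have "(\<exists>y z. x = Node y z) = (\<exists>y z. x' = Node y z)"
    unfolding x'(2) by (cases x') auto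
  then have "truth (\<exists>y z. x = Node y z) = map_data (of_rat :: rat \<Rightarrow> real) (truth (\<exists>y z. x' = Node y z))"
    by simp
  with evaluates_evaluates_list.ev_IsNode[OF x'(1)] show ?case by blast
next
  case (ev_Arith renv e r e' r' f)
  from ev_Arith.IH(2)[OF ev_Arith.prems] obtain q where
    q: "evaluates P env e (Atom q)" "r = of_rat q" by (metis map_data_eq_AtomD)
  from ev_Arith.IH(4)[OF ev_Arith.prems] obtain q' where
    q': "evaluates P env e' (Atom q')" "r' = of_rat q'" by (metis map_data_eq_AtomD)
  show ?case using evaluates_evaluates_list.ev_Arith[OF q(1) q'(1), of f] q(2) q'(2)
    by (intro exI[of _ "Atom (arith_op f q q')"]) (simp add: of_rat_arith_op)
next
  case (ev_Cond_true renv c r e x e')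
  from ev_Cond_true.IH(2)[OF ev_Cond_true.prems] obtain q where
    q: "evaluates P env c (Atom q)" "r = of_rat q" by (metis map_data_eq_AtomD)
  with ev_Cond_true.hyps have "q \<noteq> 0" by auto
  with q(1) ev_Cond_true.IH(4)[OF ev_Cond_true.prems] show ?case
    by (blast intro: evaluates_evaluates_list.ev_Cond_true)
next
  case (ev_Cond_false renv c r e' x e)
  from ev_Cond_false.IH(2)[OF ev_Cond_false.prems] obtain q where
    q: "evaluates P env c (Atom q)" "r = of_rat q" by (metis map_data_eq_AtomD)
  with ev_Cond_false.hyps have "q = 0" by auto
  with q(1) ev_Cond_false.IH(4)[OF ev_Cond_false.prems] show ?case
    by (blast intro: evaluates_evaluates_list.ev_Cond_false)
next
  case (ev_MkLeaf renv)
  show ?case by (intro exI[of _ Leaf]) (simp add: evaluates_evaluates_list.ev_MkLeaf)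
next
  case (ev_MkNode renv e x e' y)
  from ev_MkNode.IH(2)[OF ev_MkNode.prems] ev_MkNode.IH(4)[OF ev_MkNode.prems] show ?case
    by (metis data.map(3) evaluates_evaluates_list.ev_MkNode)
next
  case (ev_Call renv es xs f x)
  from ev_Call.IH(2)[OF ev_Call.prems] obtain xs' where
    xs': "evaluates_list P env es xs'" "xs = map (map_data of_rat) xs'" by blast
  from ev_Call.IH(5)[OF xs'(2)] xs'(1) ev_Call.IH(3) show ?case
    by (blast intro: evaluates_evaluates_list.ev_Call)
next
  case (ev_Nil renv)
  show ?case by (intro exI[of _ "[]"]) (simp add: evaluates_evaluates_list.ev_Nil)
next
  case (ev_Cons renv e x es xs)
  from ev_Cons.IH(2)[OF ev_Cons.prems] ev_Cons.IH(4)[OF ev_Cons.prems] show ?case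
    by (metis list.map(2) evaluates_evaluates_list.ev_Cons)
qed

lemma computes_over_rat:
  assumes "computes P (map_data (of_rat :: rat \<Rightarrow> real) x) (truth b)"
  shows "computes P x (truth b)"
proof -
  from evaluates_over_rat(1)[OF assms[unfolded computes_def], where env = "[x]"]
  obtain y where y: "evaluates P [x] (Call 0 [Var 0]) y"
    "truth b = map_data (of_rat :: rat \<Rightarrow> real) y"
    by auto
  have "y = truth b"
    using y(2) data.inj_map[of "of_rat :: rat \<Rightarrow> real"] map_data_of_rat_truth[of b]
    by (metis injD injI of_rat_eq_iff)
  with y(1) show ?thesis by (simp add: computes_def)
qed

lemma decidable_on_if_computes_real:
  assumes "\<And>i. i \<in> D \<Longrightarrow> computes P (enc i) (truth (Q i))"
  shows "decidable_on D enc Q"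
  unfolding decidable_on_def using assms computes_over_rat by (metis)

text \<open>An equational form of the semantics over the reals, by which the simplifier executes
  programs. Procedure calls (\<open>call\<close>) are kept opaque.\<close>

definition den :: "program \<Rightarrow> real data list \<Rightarrow> expr \<Rightarrow> real data option" where
  "den P env e = (if \<exists>x. evaluates P env e x then Some (THE x. evaluates P env e x) else None)"

definition den_list :: "program \<Rightarrow> real data list \<Rightarrow> expr list \<Rightarrow> real data list option" where
  "den_list P env es =
     (if \<exists>x. evaluates_list P env es x then Some (THE x. evaluates_list P env es x) else None)"

definition call :: "program \<Rightarrow> nat \<Rightarrow> real data list \<Rightarrow> real data option" where
  "call P f xs = (if f < length P then den P xs (P ! f) else None)"

lemma den_eq_Some [simp]: "den P env e = Some x \<longleftrightarrow> evaluates P env e x"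
proof -
  have "(THE y. evaluates P env e y) = x" if "evaluates P env e x" for x
    using that by (rule the_equality) (rule evaluates_deterministic(1)[OF _ that])
  then show ?thesis unfolding den_def by auto
qed

lemma den_list_eq_Some [simp]: "den_list P env es = Some xs \<longleftrightarrow> evaluates_list P env es xs"
proof -
  have "(THE ys. evaluates_list P env es ys) = xs" if "evaluates_list P env es xs" for xs
    using that by (rule the_equality) (rule evaluates_deterministic(2)[OF _ that])
  then show ?thesis unfolding den_list_def by auto
qed

lemma option_eqI: "(\<And>x. a = Some x \<longleftrightarrow> b = Some x) \<Longrightarrow> a = b"
  by (cases a; cases b) auto

fun fst_data :: "real data \<Rightarrow> real data option" where
  "fst_data (Node x y) = Some x"
| "fst_data _ = None"

fun snd_data :: "real data \<Rightarrow> real data option" where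
  "snd_data (Node x y) = Some y"
| "snd_data _ = None"

text \<open>\<open>Less\<close> has a clause of its own so that a comparison comes out as
  \<open>truth\<close> of a proposition, which \<open>cond_data_truth\<close> turns into an ordinary
  case distinction.\<close>

fun arith_data :: "arith \<Rightarrow> real data \<Rightarrow> real data \<Rightarrow> real data option" where
  "arith_data Less (Atom r) (Atom s) = Some (truth (r < s))"
| "arith_data f (Atom r) (Atom s) = Some (Atom (arith_op f r s))"
| "arith_data _ _ _ = None"

text \<open>Unlike the other operations it is not strict in its last two arguments, so a branch that
  is not taken may be undefined.\<close>

fun cond_data :: "real data option \<Rightarrow> 'b option \<Rightarrow> 'b option \<Rightarrow> 'b option" where
  "cond_data (Some (Atom r)) x y = (if r \<noteq> 0 then x else y)"
| "cond_data _ x y = None"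

text \<open>Like \<open>if_weak_cong\<close>: the simplifier works on the condition only, and a
  branch is executed only once it is known to be taken.\<close>

lemma cond_data_cong [cong]: "c = c' \<Longrightarrow> cond_data c x y = cond_data c' x y"
  by simp

lemma cond_data_truth [simp]: "cond_data (Some (truth b)) x y = (if b then x else y)"
  by (simp add: truth_def)

lemma fst_data_eq_Some: "fst_data d = Some x \<longleftrightarrow> (\<exists>y. d = Node x y)"
  by (cases d) auto

lemma snd_data_eq_Some: "snd_data d = Some x \<longleftrightarrow> (\<exists>y. d = Node y x)"
  by (cases d) auto

lemma arith_data_eq_Some:
  "arith_data f d d' = Some x \<longleftrightarrow>
     (\<exists>r s. d = Atom r \<and> d' = Atom s \<and> x = Atom (arith_op f r s))"
  by (cases "(f, d, d')" rule: arith_data.cases) (auto simp: truth_def)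

lemma cond_data_eq_Some:
  "cond_data c x y = Some z \<longleftrightarrow>
     (\<exists>r. c = Some (Atom r) \<and> (if r \<noteq> 0 then x = Some z else y = Some z))"
  by (cases "(c, x, y)" rule: cond_data.cases) auto

lemma den_simps:
  fixes P :: program
  shows
  "i < length env \<Longrightarrow> den P env (Var i) = Some (env ! i)"
  "den P env MkLeaf = Some Leaf"
  "den P env (IntConst k) = Some (Atom (of_int k))"
  "den P env (MkNode e e') =
     Option.bind (den P env e) (\<lambda>x. Option.bind (den P env e') (\<lambda>y. Some (Node x y)))"
  "den P env (Fst e) = Option.bind (den P env e) fst_data"
  "den P env (Snd e) = Option.bind (den P env e) snd_data"
  "den P env (IsAtom e) = Option.bind (den P env e) (\<lambda>x. Some (truth (\<exists>r. x = Atom r)))"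
  "den P env (IsNode e) = Option.bind (den P env e) (\<lambda>x. Some (truth (\<exists>y z. x = Node y z)))"
  "den P env (Arith g e e') =
     Option.bind (den P env e) (\<lambda>x. Option.bind (den P env e') (arith_data g x))"
  "den P env (Cond c e e') = cond_data (den P env c) (den P env e) (den P env e')"
  "den P env (Call f es) = Option.bind (den_list P env es) (call P f)"
  "den_list P env [] = Some []"
  "den_list P env (e # es) =
     Option.bind (den P env e) (\<lambda>x. Option.bind (den_list P env es) (\<lambda>xs. Some (x # xs)))"
proof -
  note iff = den_eq_Some den_list_eq_Some bind_eq_Some_conv fst_data_eq_Some snd_data_eq_Some
    arith_data_eq_Some cond_data_eq_Some option.inject
  note intros = evaluates_evaluates_list.intros
  show "i < length env \<Longrightarrow> den P env (Var i) = Some (env ! i)"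
    by (simp add: intros)
  show "den P env MkLeaf = Some Leaf" "den P env (IntConst k) = Some (Atom (of_int k))"
    "den_list P env [] = Some []"
    by (simp_all add: intros)
  show "den P env (MkNode e e') =
     Option.bind (den P env e) (\<lambda>x. Option.bind (den P env e') (\<lambda>y. Some (Node x y)))"
    by (rule option_eqI, unfold iff) (blast intro: intros elim: evaluates_MkNodeE)
  show "den P env (Fst e) = Option.bind (den P env e) fst_data"
    by (rule option_eqI, unfold iff) (blast intro: intros elim: evaluates_FstE)
  show "den P env (Snd e) = Option.bind (den P env e) snd_data"
    by (rule option_eqI, unfold iff) (blast intro: intros elim: evaluates_SndE)
  show "den P env (IsAtom e) = Option.bind (den P env e) (\<lambda>x. Some (truth (\<exists>r. x = Atom r)))"
    by (rule option_eqI, unfold iff) (fast intro: intros elim: evaluates_IsAtomE)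
  show "den P env (IsNode e) =
     Option.bind (den P env e) (\<lambda>x. Some (truth (\<exists>y z. x = Node y z)))"
    by (rule option_eqI, unfold iff) (fast intro: intros elim: evaluates_IsNodeE)
  show "den P env (Arith g e e') =
     Option.bind (den P env e) (\<lambda>x. Option.bind (den P env e') (arith_data g x))"
    by (rule option_eqI, unfold iff) (blast intro: intros elim: evaluates_ArithE)
  show "den P env (Cond c e e') = cond_data (den P env c) (den P env e) (den P env e')"
  proof (rule option_eqI)
    fix x
    show "den P env (Cond c e e') = Some x \<longleftrightarrow>
        cond_data (den P env c) (den P env e) (den P env e') = Some x"
      unfolding iff
      by (auto intro: evaluates_evaluates_list.ev_Cond_true evaluates_evaluates_list.ev_Cond_false
        elim!: evaluates_CondE split: if_splits)
  qed
  show "den P env (Call f es) = Option.bind (den_list P env es) (call P f)"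
  proof (rule option_eqI)
    fix x
    show "den P env (Call f es) = Some x \<longleftrightarrow> Option.bind (den_list P env es) (call P f) = Some x"
      unfolding iff call_def
      by (auto intro: evaluates_evaluates_list.ev_Call elim!: evaluates_CallE split: if_splits)
  qed
  show "den_list P env (e # es) =
     Option.bind (den P env e) (\<lambda>x. Option.bind (den_list P env es) (\<lambda>xs. Some (x # xs)))"
    by (rule option_eqI, unfold iff) (blast intro: intros elim: evaluates_list_ConsE)
qed

section \<open>The algorithm as higher-order functions\<close>

text \<open>Between two events every position is a quadratic polynomial in the elapsed time; \<open>(a, b, c)\<close>
  stands for \<open>a + b t + c t\<^sup>2\<close>.\<close>

type_synonym quad = "real \<times> real \<times> real"

fun quad_val :: "quad \<Rightarrow> real \<Rightarrow> real" where
  "quad_val (a, b, c) t = a + b * t + c * t^2"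

text \<open>The factor 1 shifts an end by an offset; the factor 1/2 yields the midpoint of two
  ends.\<close>

fun quad_comb :: "real \<Rightarrow> quad \<Rightarrow> quad \<Rightarrow> quad" where
  "quad_comb k (a, b, c) (a', b', c') = ((a + a') * k, (b + b') * k, (c + c') * k)"

section \<open>Boolean combinations of sign conditions and the translation into them\<close>

datatype qf = Pos quad | QNot qf | QAnd qf qf

fun holds :: "qf \<Rightarrow> real \<Rightarrow> bool" where
  "holds (Pos p) t \<longleftrightarrow> 0 < quad_val p t"
| "holds (QNot \<alpha>) t \<longleftrightarrow> \<not> holds \<alpha> t"
| "holds (QAnd \<alpha> \<beta>) t \<longleftrightarrow> holds \<alpha> t \<and> holds \<beta> t"

definition qtrue :: qf where "qtrue = Pos (1, 0, 0)"

definition qfalse :: qf where "qfalse = Pos (0, 0, 0)"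

definition qor :: "qf \<Rightarrow> qf \<Rightarrow> qf" where
  "qor \<alpha> \<beta> = QNot (QAnd (QNot \<alpha>) (QNot \<beta>))"

fun qdisj :: "qf list \<Rightarrow> qf" where
  "qdisj [] = qfalse"
| "qdisj (\<alpha> # \<alpha>s) = qor \<alpha> (qdisj \<alpha>s)"

fun qless :: "quad \<Rightarrow> quad \<Rightarrow> qf" where
  "qless (a, b, c) (a', b', c') = Pos (a' - a, b' - b, c' - c)"

definition qle :: "quad \<Rightarrow> quad \<Rightarrow> qf" where
  "qle p q = QNot (qless q p)"

fun pairs :: "real \<Rightarrow> quad list \<Rightarrow> quad list \<Rightarrow> quad list" where
  "pairs k [] ys = []"
| "pairs k (x # xs) ys = map (quad_comb k x) ys @ pairs k xs ys"

text \<open>Whether \<open>\<phi>\<close> holds on an interval depends only on the order of the endpoints relative to car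
  ends shifted by offsets of \<open>\<phi>\<close>, and on how the length compares with the offsets. Eliminating a chop point
  adds up two offsets.\<close>

fun offsets :: "mlsl \<Rightarrow> quad list" where
  "offsets (LenEq q) = [(0, 0, 0), (of_rat q, 0, 0), (- of_rat q, 0, 0)]"
| "offsets (Neg \<phi>) = offsets \<phi>"
| "offsets (Conj \<phi> \<psi>) = offsets \<phi> @ offsets \<psi>"
| "offsets (Ex c \<phi>) = offsets \<phi>"
| "offsets (HChop \<phi> \<psi>) = pairs 1 (offsets \<phi> @ offsets \<psi>) (offsets \<phi> @ offsets \<psi>)"
| "offsets (VChop \<phi> \<psi>) = offsets \<phi> @ offsets \<psi>"
| "offsets _ = [(0, 0, 0)]"

datatype shape = Shape (car_id: nat) (rear: quad) (front: quad)
  (reserved: "lane list") (claimed: "lane list")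

fun ends :: "shape list \<Rightarrow> quad list" where
  "ends [] = []"
| "ends (s # G) = rear s # front s # ends G"

fun lookup :: "(cvar \<times> car) list \<Rightarrow> cvar \<Rightarrow> car" where
  "lookup [] c = 0"
| "lookup ((d, C) # N) c = (if d = c then C else lookup N c)"

fun find_shape :: "shape list \<Rightarrow> car \<Rightarrow> shape" where
  "find_shape [] C = Shape 0 (0, 0, 0) (0, 0, 0) [] []"
| "find_shape (s # G) C = (if car_id s = C then s else find_shape G C)"

fun qvacant :: "shape list \<Rightarrow> lane \<Rightarrow> quad \<Rightarrow> quad \<Rightarrow> qf" where
  "qvacant [] l lo hi = qtrue"
| "qvacant (s # G) l lo hi =
     (if l \<in> set (reserved s @ claimed s)
      then QAnd (QNot (QAnd (qless (rear s) hi) (qless lo (front s)))) (qvacant G l lo hi)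
      else qvacant G l lo hi)"

definition qcover :: "lane \<Rightarrow> lane \<Rightarrow> shape \<Rightarrow> lane list \<Rightarrow> quad \<Rightarrow> quad \<Rightarrow> qf" where
  "qcover l n s ls lo hi =
     (if l = n \<and> l \<in> set ls
      then QAnd (qless lo hi) (QAnd (qle (rear s) lo) (qle hi (front s))) else qfalse)"

text \<open>The borders of the interval count as ends, since the parts of the chop may constrain the
  distance of the chop point from them. Pairing an end with itself yields that end.\<close>

definition chop_points :: "shape list \<Rightarrow> mlsl \<Rightarrow> mlsl \<Rightarrow> quad \<Rightarrow> quad \<Rightarrow> quad list" where
  "chop_points G \<phi> \<psi> lo hi =
     (let K = pairs 1 (lo # hi # ends G) (offsets \<phi> @ offsets \<psi>) in pairs (1/2) K K)"

text \<open>A candidate chop point may lie inside the interval for some z and outside for others, so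
  every disjunct of the \<open>HChop\<close> case tests this for itself.\<close>

primrec qe :: "shape list \<Rightarrow> mlsl \<Rightarrow> (cvar \<times> car) list \<Rightarrow> lane \<Rightarrow> lane \<Rightarrow> quad \<Rightarrow> quad \<Rightarrow> qf" where
  "qe G (Same c d) N l n lo hi = (if lookup N c = lookup N d then qtrue else qfalse)"
| "qe G Free N l n lo hi =
     (if l = n then QAnd (qless lo hi) (qvacant G l lo hi) else qfalse)"
| "qe G (Re c) N l n lo hi = (let s = find_shape G (lookup N c) in qcover l n s (reserved s) lo hi)"
| "qe G (Cl c) N l n lo hi = (let s = find_shape G (lookup N c) in qcover l n s (claimed s) lo hi)"
| "qe G (LenEq q) N l n lo hi =
     (let lo' = quad_comb 1 lo (of_rat q, 0, 0) in QAnd (qle lo' hi) (qle hi lo'))"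
| "qe G (Neg \<phi>) N l n lo hi = QNot (qe G \<phi> N l n lo hi)"
| "qe G (Conj \<phi> \<psi>) N l n lo hi = QAnd (qe G \<phi> N l n lo hi) (qe G \<psi> N l n lo hi)"
| "qe G (Ex c \<phi>) N l n lo hi =
     qdisj (map (\<lambda>s. qe G \<phi> ((CVar c, car_id s) # N) l n lo hi) G)"
| "qe G (HChop \<phi> \<psi>) N l n lo hi =
     qdisj (map (\<lambda>s. QAnd (QAnd (qle lo s) (qle s hi)) (QAnd (qe G \<phi> N l n lo s) (qe G \<psi> N l n s hi)))
       (chop_points G \<phi> \<psi> lo hi))"
| "qe G (VChop \<psi> \<phi>) N l n lo hi =
     (if l \<le> n then qdisj (map (\<lambda>m. QAnd (qe G \<phi> N l m lo hi) (qe G \<psi> N (m + 1) n lo hi)) [l - 1..n])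
      else QAnd (qe G \<phi> N l n lo hi) (qe G \<psi> N l n lo hi))"

text \<open>A sample \<open>(x, e, D)\<close> stands for the point \<open>x + e \<surd>D\<close>.\<close>

definition surd_pos :: "real \<Rightarrow> real \<Rightarrow> real \<Rightarrow> bool" where
  "surd_pos a b D \<longleftrightarrow> (if 0 < a then 0 \<le> b \<or> b * b * D < a * a else 0 < b \<and> a * a < b * b * D)"

text \<open>Substituting x + e \<open>sqrt D\<close> into the polynomial leaves a part free of the
  root and a multiple of \<open>sqrt D\<close>; these are the first two arguments of
  \<open>surd_pos\<close>.\<close>

fun pos_at :: "quad \<Rightarrow> quad \<Rightarrow> bool" where
  "pos_at (a, b, c) (x, e, D) \<longleftrightarrow> surd_pos (a + b * x + c * (x * x + e * e * D)) (b * e + 2 * c * x * e) D"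

text \<open>The sign just to the right of a point is that of the first nonzero Taylor coefficient
  there: the value, then the derivative (b, 2c, 0), then c. Negation is written as subtraction from
  0 because that is how the program computes it.\<close>

fun pos_after :: "quad \<Rightarrow> quad \<Rightarrow> bool" where
  "pos_after (a, b, c) s \<longleftrightarrow>
     pos_at (a, b, c) s \<or> \<not> pos_at (0 - a, 0 - b, 0 - c) s \<and>
       (pos_at (b, 2 * c, 0) s \<or> \<not> pos_at (0 - b, 0 - 2 * c, 0) s \<and> 0 < c)"

fun holds_at :: "bool \<Rightarrow> quad \<Rightarrow> qf \<Rightarrow> bool" where
  "holds_at after s (Pos p) \<longleftrightarrow> (if after then pos_after p s else pos_at p s)"
| "holds_at after s (QNot \<alpha>) \<longleftrightarrow> \<not> holds_at after s \<alpha>"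
| "holds_at after s (QAnd \<alpha> \<beta>) \<longleftrightarrow> holds_at after s \<alpha> \<and> holds_at after s \<beta>"

text \<open>The polynomials (0, 1, 0) and (b, -1, 0) are z and b - z, so the guard keeps exactly the
  real samples strictly between 0 and b.\<close>

fun check_sample :: "qf \<Rightarrow> real \<Rightarrow> quad \<Rightarrow> bool" where
  "check_sample \<alpha> b (x, e, D) \<longleftrightarrow>
     (0 \<le> D \<and> pos_at (0, 1, 0) (x, e, D) \<and> pos_at (b, -1, 0) (x, e, D) \<longrightarrow>
       holds_at False (x, e, D) \<alpha> \<and> holds_at True (x, e, D) \<alpha>)"

text \<open>For a linear polynomial the two candidates for quadratic roots degenerate to the harmless
  sample 0, since division by zero yields zero; likewise the third one when \<open>c\<^sub>1 = 0\<close>.\<close>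

fun check_roots :: "qf \<Rightarrow> real \<Rightarrow> qf \<Rightarrow> bool" where
  "check_roots \<alpha> b (Pos (c0, c1, c2)) \<longleftrightarrow>
     check_sample \<alpha> b ((0 - c1) / (2 * c2), 1, (c1 * c1 - 4 * c0 * c2) / (4 * c2 * c2)) \<and>
     check_sample \<alpha> b ((0 - c1) / (2 * c2), -1, (c1 * c1 - 4 * c0 * c2) / (4 * c2 * c2)) \<and>
     check_sample \<alpha> b ((0 - c0) / c1, 0, 0)"
| "check_roots \<alpha> b (QNot \<beta>) \<longleftrightarrow> check_roots \<alpha> b \<beta>"
| "check_roots \<alpha> b (QAnd \<beta> \<gamma>) \<longleftrightarrow> check_roots \<alpha> b \<beta> \<and> check_roots \<alpha> b \<gamma>"

definition check_interval :: "qf \<Rightarrow> real \<Rightarrow> bool" where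
  "check_interval \<alpha> b \<longleftrightarrow>
     (0 < b \<longrightarrow> holds_at False (0, 0, 0) \<alpha> \<and> holds_at True (0, 0, 0) \<alpha> \<and> check_roots \<alpha> b \<alpha>)"

section \<open>Segments between events and the traversal of the timed word\<close>

datatype car_state = CarState nat real real real real real "lane list" "lane list"

text \<open>The coefficients of the front come from expanding (v + a z)^2 / b, the braking distance
  after time z, and adding position and physical length.\<close>

fun shape_of :: "real \<Rightarrow> car_state \<Rightarrow> shape" where
  "shape_of b (CarState C p x y v a R K) =
     Shape C (x, v, a / 2) (x + (v * v / b + p), v + 2 * v * a / b, a / 2 + a * a / b) R K"

fun advance :: "real \<Rightarrow> car_state \<Rightarrow> car_state" where
  "advance z (CarState C p x y v a R K) = CarState C p (x + v * z + a * z * z / 2) y (v + a * z) a R K"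

text \<open>The guards of the transitions are not tested, since admissibility provides them. The
  lane lists may repeat a lane; they stand for sets.\<close>

fun act :: "symbol \<Rightarrow> car_state \<Rightarrow> car_state" where
  "act Dagger s = s"
| "act (Act (Claim D n)) (CarState C p x y v a R K) =
     CarState C p x y v a R (if D = C then [n] else K)"
| "act (Act (Reserve D)) (CarState C p x y v a R K) =
     (if D = C then CarState C p x y v a (R @ K) [] else CarState C p x y v a R K)"
| "act (Act (WdClaim D)) (CarState C p x y v a R K) =
     CarState C p x y v a R (if D = C then [] else K)"
| "act (Act (WdReserve D n)) (CarState C p x y v a R K) =
     CarState C p x y v a (if D = C then [n] else R) K"
| "act (Act (Accel D a')) (CarState C p x y v a R K) =
     CarState C p x y v (if D = C then a' else a) R K"

text \<open>The view moves with its owner, so each border is the owner's rear plus a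
  constant.\<close>

definition segment :: "real \<Rightarrow> real \<Rightarrow> real \<Rightarrow> car \<Rightarrow> lane \<Rightarrow> lane \<Rightarrow> (cvar \<times> car) list \<Rightarrow> mlsl \<Rightarrow>
    car_state list \<Rightarrow> qf" where
  "segment b rl rh E l n N \<phi> S =
     (let G = map (shape_of b) S; s = find_shape G E
      in qe G \<phi> N l n (quad_comb 1 (rear s) (rl, 0, 0)) (quad_comb 1 (rear s) (rh, 0, 0)))"

text \<open>Each segment is closed on the left and open on the right, because at time \<tau>' the
  symbol \<sigma> has already taken effect. Between simultaneous symbols the segment is empty and
  nothing is inspected; after the last symbol a single instant remains.\<close>

fun solve :: "(car_state list \<Rightarrow> qf) \<Rightarrow> real \<Rightarrow> car_state list \<Rightarrow> timed_word \<Rightarrow> bool" where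
  "solve F \<tau> S [] \<longleftrightarrow> holds_at False (0, 0, 0) (F S)"
| "solve F \<tau> S ((\<sigma>, \<tau>') # w) \<longleftrightarrow>
     check_interval (F S) (\<tau>' - \<tau>) \<and> solve F \<tau>' (map (\<lambda>s. act \<sigma> (advance (\<tau>' - \<tau>) s)) S) w"


section \<open>The program\<close>

subsection \<open>Data\<close>

fun quad_data :: "quad \<Rightarrow> real data" where
  "quad_data (a, b, c) = Node (Atom a) (Node (Atom b) (Atom c))"

text \<open>No tags are needed: the left component is an atom for a polynomial, a leaf for a
  negation and a node for a conjunction.\<close>

fun qf_data :: "qf \<Rightarrow> real data" where
  "qf_data (Pos p) = quad_data p"
| "qf_data (QNot \<alpha>) = Node Leaf (qf_data \<alpha>)"
| "qf_data (QAnd \<alpha> \<beta>) = Node (qf_data \<alpha>) (qf_data \<beta>)"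

definition quads_data :: "quad list \<Rightarrow> real data" where
  "quads_data ps = list_data (map quad_data ps)"

definition ints_data :: "int list \<Rightarrow> real data" where
  "ints_data ls = list_data (map int_data ls)"

fun shape_data :: "shape \<Rightarrow> real data" where
  "shape_data (Shape C p q R K) =
     list_data [nat_data C, quad_data p, quad_data q, ints_data R, ints_data K]"

definition shapes_data :: "shape list \<Rightarrow> real data" where
  "shapes_data G = list_data (map shape_data G)"

fun binding_data :: "cvar \<times> car \<Rightarrow> real data" where
  "binding_data (c, C) = Node (cvar_data c) (nat_data C)"

definition bindings_data :: "(cvar \<times> car) list \<Rightarrow> real data" where
  "bindings_data N = list_data (map binding_data N)"

text \<open>The layout is that of an entry in \<open>cars_data\<close>, so the list of cars in the
  input already encodes the initial states.\<close>

fun car_state_data :: "car_state \<Rightarrow> real data" where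
  "car_state_data (CarState C p x y v a R K) = list_data [nat_data C, Atom p, Atom x, Atom y, Atom v,
     Atom a, ints_data R, ints_data K]"

definition states_data :: "car_state list \<Rightarrow> real data" where
  "states_data S = list_data (map car_state_data S)"

lemma list_data_simps [simp]:
  "list_data [] = Leaf" "list_data (x # xs) = Node x (list_data xs)"
  "quads_data [] = Leaf" "quads_data (p # ps) = Node (quad_data p) (quads_data ps)"
  "ints_data [] = Leaf" "ints_data (l # ls) = Node (int_data l) (ints_data ls)"
  "shapes_data [] = Leaf" "shapes_data (s # G) = Node (shape_data s) (shapes_data G)"
  "bindings_data [] = Leaf" "bindings_data (b # N) = Node (binding_data b) (bindings_data N)"
  "states_data [] = Leaf" "states_data (c # S) = Node (car_state_data c) (states_data S)"
  "word_data [] = Leaf" "word_data ((\<sigma>, \<tau>) # w) = Node (Node (symbol_data \<sigma>) (Atom \<tau>)) (word_data w)"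
  by (simp_all add: list_data_def quads_data_def ints_data_def shapes_data_def bindings_data_def
      states_data_def word_data_def)

lemma qf_data_neq_Atom [simp]: "qf_data \<alpha> \<noteq> Atom r"
  by (cases \<alpha>) auto

lemma qf_data_is_Node [simp]: "\<exists>y z. qf_data \<alpha> = Node y z"
  by (cases \<alpha>) auto

definition cvar_code :: "cvar \<Rightarrow> nat" where
  "cvar_code c = (case c of Ego \<Rightarrow> 0 | CVar i \<Rightarrow> Suc i)"

lemma cvar_data_code: "cvar_data c = Atom (real (cvar_code c))"
  by (cases c) (auto simp: nat_data_def cvar_code_def)

lemma cvar_code_eq_iff [simp]: "cvar_code c = cvar_code d \<longleftrightarrow> c = d"
  by (auto simp: cvar_code_def split: cvar.splits)

subsection \<open>Procedures\<close>

text \<open>The numbers are positions in \<open>prog\<close>. \<open>Suc 0\<close> is the form to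
  which the simplifier reduces the natural number 1.\<close>

abbreviation (input) "comb_proc \<equiv> Suc 0"
abbreviation (input) "less_proc \<equiv> 2 :: nat"
abbreviation (input) "append_proc \<equiv> 3 :: nat"
abbreviation (input) "pairs1_proc \<equiv> 4 :: nat"
abbreviation (input) "pairs_proc \<equiv> 5 :: nat"
abbreviation (input) "offsets_proc \<equiv> 6 :: nat"
abbreviation (input) "ends_proc \<equiv> 7 :: nat"
abbreviation (input) "lookup_proc \<equiv> 8 :: nat"
abbreviation (input) "find_proc \<equiv> 9 :: nat"
abbreviation (input) "mem_proc \<equiv> 10 :: nat"
abbreviation (input) "vacant_proc \<equiv> 11 :: nat"
abbreviation (input) "cover_proc \<equiv> 12 :: nat"
abbreviation (input) "qe_proc \<equiv> 13 :: nat"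
abbreviation (input) "ex_proc \<equiv> 14 :: nat"
abbreviation (input) "hchop_proc \<equiv> 15 :: nat"
abbreviation (input) "vchop_proc \<equiv> 16 :: nat"
abbreviation (input) "surd_proc \<equiv> 17 :: nat"
abbreviation (input) "pos_at_proc \<equiv> 18 :: nat"
abbreviation (input) "pos_after_proc \<equiv> 19 :: nat"
abbreviation (input) "holds_at_proc \<equiv> 20 :: nat"
abbreviation (input) "check_sample_proc \<equiv> 21 :: nat"
abbreviation (input) "check_roots_proc \<equiv> 22 :: nat"
abbreviation (input) "check_interval_proc \<equiv> 23 :: nat"
abbreviation (input) "shapes_proc \<equiv> 24 :: nat"
abbreviation (input) "advance_proc \<equiv> 25 :: nat"
abbreviation (input) "act_proc \<equiv> 26 :: nat"
abbreviation (input) "step_proc \<equiv> 27 :: nat"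
abbreviation (input) "segment_proc \<equiv> 28 :: nat"
abbreviation (input) "solve_proc \<equiv> 29 :: nat"
abbreviation (input) "mids_proc \<equiv> 30 :: nat"

abbreviation e_add (infixl "+.." 65) where "a +.. b \<equiv> Arith Add a b"
abbreviation e_sub (infixl "-.." 65) where "a -.. b \<equiv> Arith Sub a b"
abbreviation e_mul (infixl "*.." 70) where "a *.. b \<equiv> Arith Mul a b"
abbreviation e_div (infixl "'/.." 70) where "a /.. b \<equiv> Arith Div a b"
abbreviation e_less (infix "<.." 50) where "a <.. b \<equiv> Arith Less a b"
abbreviation "lit \<equiv> IntConst"
abbreviation "enot a \<equiv> Cond a (lit 0) (lit 1)"
abbreviation "eand a b \<equiv> Cond a b (lit 0)"
abbreviation "eor a b \<equiv> Cond a (lit 1) b"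
text \<open>The only predicate on numbers is a strict comparison, so equality means that both
  comparisons fail.\<close>

abbreviation e_eq (infix "=.." 50) where "a =.. b \<equiv> Cond (a <.. b) (lit 0) (enot (b <.. a))"
abbreviation "triple a b c \<equiv> MkNode a (MkNode b c)"
abbreviation "elist es \<equiv> foldr MkNode es MkLeaf"
abbreviation "el1 e \<equiv> Fst (Snd e)"
abbreviation "el2 e \<equiv> Fst (Snd (Snd e))"
abbreviation "el3 e \<equiv> Fst (Snd (Snd (Snd e)))"
abbreviation "el4 e \<equiv> Fst (Snd (Snd (Snd (Snd e))))"
abbreviation "el5 e \<equiv> Fst (Snd (Snd (Snd (Snd (Snd e)))))"
abbreviation "el6 e \<equiv> Fst (Snd (Snd (Snd (Snd (Snd (Snd e))))))"
abbreviation "el7 e \<equiv> Fst (Snd (Snd (Snd (Snd (Snd (Snd (Snd e)))))))"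
abbreviation "enull \<equiv> triple (lit 0) (lit 0) (lit 0)"
abbreviation "eqtrue \<equiv> triple (lit 1) (lit 0) (lit 0)"
abbreviation "eqnot a \<equiv> MkNode MkLeaf a"
abbreviation "eqor a b \<equiv> eqnot (MkNode (eqnot a) (eqnot b))"
abbreviation "ecomb p q k \<equiv> Call comb_proc [p, q, k]"
abbreviation "eless p q \<equiv> Call less_proc [p, q]"
abbreviation "ele p q \<equiv> eqnot (eless q p)"
abbreviation "eappend xs ys \<equiv> Call append_proc [xs, ys]"

section \<open>Bodies for the translation of formulas\<close>

definition comb_body where
  "comb_body = triple ((Fst (Var 0) +.. Fst (Var 1)) *.. Var 2)
     ((el1 (Var 0) +.. el1 (Var 1)) *.. Var 2)
     ((Snd (Snd (Var 0)) +.. Snd (Snd (Var 1))) *.. Var 2)"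

definition less_body where
  "less_body = triple (Fst (Var 1) -.. Fst (Var 0)) (el1 (Var 1) -.. el1 (Var 0))
     (Snd (Snd (Var 1)) -.. Snd (Snd (Var 0)))"

definition append_body where
  "append_body = Cond (IsNode (Var 0)) (MkNode (Fst (Var 0)) (eappend (Snd (Var 0)) (Var 1))) (Var 1)"

definition pairs1_body where
  "pairs1_body = Cond (IsNode (Var 1))
     (MkNode (ecomb (Var 0) (Fst (Var 1)) (Var 2)) (Call pairs1_proc [Var 0, Snd (Var 1), Var 2])) MkLeaf"

definition pairs_body where
  "pairs_body = Cond (IsNode (Var 0))
     (eappend (Call pairs1_proc [Fst (Var 0), Var 1, Var 2]) (Call pairs_proc [Snd (Var 0), Var 1, Var 2])) MkLeaf"

text \<open>Case distinction on the tag of \<open>mlsl_data\<close> by a cascade of upper bounds.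
  Tags 0 to 3 are the atoms without a length constraint and share the first branch.\<close>

definition offsets_body where
  "offsets_body =
     Cond (Fst (Var 0) <.. lit 4) (elist [enull])
     (Cond (Fst (Var 0) <.. lit 5) (elist [enull, triple (el1 (Var 0)) (lit 0) (lit 0),
       triple (lit 0 -.. el1 (Var 0)) (lit 0) (lit 0)])
     (Cond (Fst (Var 0) <.. lit 6) (Call offsets_proc [el1 (Var 0)])
     (Cond (Fst (Var 0) <.. lit 7) (eappend (Call offsets_proc [el1 (Var 0)]) (Call offsets_proc [el2 (Var 0)]))
     (Cond (Fst (Var 0) <.. lit 8) (Call offsets_proc [el2 (Var 0)])
     (Cond (Fst (Var 0) <.. lit 9)
       (Call pairs_proc [eappend (Call offsets_proc [el1 (Var 0)]) (Call offsets_proc [el2 (Var 0)]),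
                eappend (Call offsets_proc [el1 (Var 0)]) (Call offsets_proc [el2 (Var 0)]), lit 1])
     (eappend (Call offsets_proc [el1 (Var 0)]) (Call offsets_proc [el2 (Var 0)])))))))"

definition ends_body where
  "ends_body = Cond (IsNode (Var 0))
     (MkNode (el1 (Fst (Var 0))) (MkNode (el2 (Fst (Var 0))) (Call ends_proc [Snd (Var 0)]))) MkLeaf"

definition lookup_body where
  "lookup_body = Cond (IsNode (Var 0))
     (Cond (Fst (Fst (Var 0)) =.. Var 1) (Snd (Fst (Var 0))) (Call lookup_proc [Snd (Var 0), Var 1])) (lit 0)"

definition find_body where
  "find_body = Cond (IsNode (Var 0))
     (Cond (Fst (Fst (Var 0)) =.. Var 1) (Fst (Var 0)) (Call find_proc [Snd (Var 0), Var 1]))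
     (elist [lit 0, enull, enull, MkLeaf, MkLeaf])"

definition mem_body where
  "mem_body = Cond (IsNode (Var 1))
     (Cond (Fst (Var 1) =.. Var 0) (lit 1) (Call mem_proc [Var 0, Snd (Var 1)])) (lit 0)"

definition vacant_body where
  "vacant_body = Cond (IsNode (Var 0))
     (Cond (Call mem_proc [Var 1, eappend (el3 (Fst (Var 0))) (el4 (Fst (Var 0)))])
       (MkNode (eqnot (MkNode (eless (el1 (Fst (Var 0))) (Var 3)) (eless (Var 2) (el2 (Fst (Var 0))))))
         (Call vacant_proc [Snd (Var 0), Var 1, Var 2, Var 3]))
       (Call vacant_proc [Snd (Var 0), Var 1, Var 2, Var 3])) eqtrue"

definition cover_body where
  "cover_body = Cond (eand (Var 0 =.. Var 1) (Call mem_proc [Var 0, Var 3]))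
     (MkNode (eless (Var 4) (Var 5)) (MkNode (ele (el1 (Var 2)) (Var 4)) (ele (Var 5) (el2 (Var 2)))))
     enull"

text \<open>Arguments: formula, bindings, lowest and highest lane, left and right end, shapes.\<close>

definition qe_body where
  "qe_body =
     Cond (Fst (Var 0) <.. lit 1)
       (Cond (Call lookup_proc [Var 1, el1 (Var 0)] =.. Call lookup_proc [Var 1, el2 (Var 0)]) eqtrue enull)
     (Cond (Fst (Var 0) <.. lit 2)
       (Cond (Var 2 =.. Var 3)
         (MkNode (eless (Var 4) (Var 5)) (Call vacant_proc [Var 6, Var 2, Var 4, Var 5])) enull)
     (Cond (Fst (Var 0) <.. lit 3)
       (Call cover_proc [Var 2, Var 3, Call find_proc [Var 6, Call lookup_proc [Var 1, el1 (Var 0)]],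
         el3 (Call find_proc [Var 6, Call lookup_proc [Var 1, el1 (Var 0)]]), Var 4, Var 5])
     (Cond (Fst (Var 0) <.. lit 4)
       (Call cover_proc [Var 2, Var 3, Call find_proc [Var 6, Call lookup_proc [Var 1, el1 (Var 0)]],
         el4 (Call find_proc [Var 6, Call lookup_proc [Var 1, el1 (Var 0)]]), Var 4, Var 5])
     (Cond (Fst (Var 0) <.. lit 5)
       (MkNode (ele (ecomb (Var 4) (triple (el1 (Var 0)) (lit 0) (lit 0)) (lit 1)) (Var 5))
         (ele (Var 5) (ecomb (Var 4) (triple (el1 (Var 0)) (lit 0) (lit 0)) (lit 1))))
     (Cond (Fst (Var 0) <.. lit 6)
       (eqnot (Call qe_proc [el1 (Var 0), Var 1, Var 2, Var 3, Var 4, Var 5, Var 6]))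
     (Cond (Fst (Var 0) <.. lit 7)
       (MkNode (Call qe_proc [el1 (Var 0), Var 1, Var 2, Var 3, Var 4, Var 5, Var 6])
         (Call qe_proc [el2 (Var 0), Var 1, Var 2, Var 3, Var 4, Var 5, Var 6]))
     (Cond (Fst (Var 0) <.. lit 8)
       (Call ex_proc [Var 6, el1 (Var 0), el2 (Var 0), Var 1, Var 2, Var 3, Var 4, Var 5, Var 6])
     (Cond (Fst (Var 0) <.. lit 9)
       (Call hchop_proc [Call mids_proc [Call pairs_proc [MkNode (Var 4) (MkNode (Var 5) (Call ends_proc [Var 6])),
           eappend (Call offsets_proc [el1 (Var 0)]) (Call offsets_proc [el2 (Var 0)]), lit 1]],
         el1 (Var 0), el2 (Var 0), Var 1, Var 2, Var 3, Var 4, Var 5, Var 6])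
     (Cond (Var 3 <.. Var 2)
       (MkNode (Call qe_proc [el2 (Var 0), Var 1, Var 2, Var 3, Var 4, Var 5, Var 6])
         (Call qe_proc [el1 (Var 0), Var 1, Var 2, Var 3, Var 4, Var 5, Var 6]))
       (Call vchop_proc [Var 2 -.. lit 1, el2 (Var 0), el1 (Var 0), Var 1, Var 2, Var 3, Var 4, Var 5,
         Var 6]))))))))))"

text \<open>The language is first-order, so each \<open>map\<close> in \<open>qe\<close> becomes a
  loop: \<open>Var 0\<close> is what remains to be visited (cars, chop points, or lanes counted
  upwards), and the other arguments are handed on.\<close>

definition ex_body where
  "ex_body = Cond (IsNode (Var 0))
     (eqor (Call qe_proc [Var 2, MkNode (MkNode (Var 1) (Fst (Fst (Var 0)))) (Var 3), Var 4, Var 5, Var 6,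
         Var 7, Var 8])
       (Call ex_proc [Snd (Var 0), Var 1, Var 2, Var 3, Var 4, Var 5, Var 6, Var 7, Var 8])) enull"

definition hchop_body where
  "hchop_body = Cond (IsNode (Var 0))
     (eqor (MkNode (MkNode (ele (Var 6) (Fst (Var 0))) (ele (Fst (Var 0)) (Var 7)))
         (MkNode (Call qe_proc [Var 1, Var 3, Var 4, Var 5, Var 6, Fst (Var 0), Var 8])
           (Call qe_proc [Var 2, Var 3, Var 4, Var 5, Fst (Var 0), Var 7, Var 8])))
       (Call hchop_proc [Snd (Var 0), Var 1, Var 2, Var 3, Var 4, Var 5, Var 6, Var 7, Var 8])) enull"

definition vchop_body where
  "vchop_body = Cond (Var 5 <.. Var 0) enull
     (eqor (MkNode (Call qe_proc [Var 1, Var 3, Var 4, Var 0, Var 6, Var 7, Var 8])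
         (Call qe_proc [Var 2, Var 3, Var 0 +.. lit 1, Var 5, Var 6, Var 7, Var 8]))
       (Call vchop_proc [Var 0 +.. lit 1, Var 1, Var 2, Var 3, Var 4, Var 5, Var 6, Var 7, Var 8]))"

section \<open>Bodies for sign tests and for the check of an interval\<close>

definition surd_body where
  "surd_body = Cond (lit 0 <.. Var 0)
     (eor (enot (Var 1 <.. lit 0)) (Var 1 *.. Var 1 *.. Var 2 <.. Var 0 *.. Var 0))
     (eand (lit 0 <.. Var 1) (Var 0 *.. Var 0 <.. Var 1 *.. Var 1 *.. Var 2))"

definition pos_at_body where
  "pos_at_body = Call 17
     [Fst (Var 0) +.. el1 (Var 0) *.. Fst (Var 1) +.. Snd (Snd (Var 0)) *..
        (Fst (Var 1) *.. Fst (Var 1) +.. el1 (Var 1) *.. el1 (Var 1) *.. Snd (Snd (Var 1))),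
      el1 (Var 0) *.. el1 (Var 1) +.. lit 2 *.. Snd (Snd (Var 0)) *.. Fst (Var 1) *.. el1 (Var 1),
      Snd (Snd (Var 1))]"

definition pos_after_body where
  "pos_after_body = eor (Call pos_at_proc [Var 0, Var 1])
     (eand (enot (Call pos_at_proc [triple (lit 0 -.. Fst (Var 0)) (lit 0 -.. el1 (Var 0))
         (lit 0 -.. Snd (Snd (Var 0))), Var 1]))
       (eor (Call pos_at_proc [triple (el1 (Var 0)) (lit 2 *.. Snd (Snd (Var 0))) (lit 0), Var 1])
         (eand (enot (Call pos_at_proc [triple (lit 0 -.. el1 (Var 0)) (lit 0 -.. lit 2 *.. Snd (Snd (Var 0)))
             (lit 0), Var 1]))
           (lit 0 <.. Snd (Snd (Var 0))))))"

definition holds_at_body where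
  "holds_at_body = Cond (IsAtom (Fst (Var 2)))
     (Cond (Var 0) (Call pos_after_proc [Var 2, Var 1]) (Call pos_at_proc [Var 2, Var 1]))
     (Cond (IsNode (Fst (Var 2)))
       (eand (Call holds_at_proc [Var 0, Var 1, Fst (Var 2)]) (Call holds_at_proc [Var 0, Var 1, Snd (Var 2)]))
       (enot (Call holds_at_proc [Var 0, Var 1, Snd (Var 2)])))"

definition check_sample_body where
  "check_sample_body = Cond
     (eand (enot (Snd (Snd (Var 2)) <.. lit 0))
       (eand (Call pos_at_proc [triple (lit 0) (lit 1) (lit 0), Var 2])
         (Call pos_at_proc [triple (Var 1) (lit (-1)) (lit 0), Var 2])))
     (eand (Call holds_at_proc [lit 0, Var 2, Var 0]) (Call holds_at_proc [lit 1, Var 2, Var 0])) (lit 1)"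

definition check_roots_body where
  "check_roots_body = Cond (IsAtom (Fst (Var 2)))
     (eand (Call check_sample_proc [Var 0, Var 1, triple ((lit 0 -.. el1 (Var 2)) /.. (lit 2 *.. Snd (Snd (Var 2))))
         (lit 1) ((el1 (Var 2) *.. el1 (Var 2) -.. lit 4 *.. Fst (Var 2) *.. Snd (Snd (Var 2)))
           /.. (lit 4 *.. Snd (Snd (Var 2)) *.. Snd (Snd (Var 2))))])
     (eand (Call check_sample_proc [Var 0, Var 1, triple ((lit 0 -.. el1 (Var 2)) /.. (lit 2 *.. Snd (Snd (Var 2))))
         (lit (-1)) ((el1 (Var 2) *.. el1 (Var 2) -.. lit 4 *.. Fst (Var 2) *.. Snd (Snd (Var 2)))
           /.. (lit 4 *.. Snd (Snd (Var 2)) *.. Snd (Snd (Var 2))))])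
       (Call check_sample_proc [Var 0, Var 1, triple ((lit 0 -.. Fst (Var 2)) /.. el1 (Var 2)) (lit 0) (lit 0)])))
     (Cond (IsNode (Fst (Var 2)))
       (eand (Call check_roots_proc [Var 0, Var 1, Fst (Var 2)]) (Call check_roots_proc [Var 0, Var 1, Snd (Var 2)]))
       (Call check_roots_proc [Var 0, Var 1, Snd (Var 2)]))"

definition check_interval_body where
  "check_interval_body = Cond (lit 0 <.. Var 1)
     (eand (Call holds_at_proc [lit 0, enull, Var 0]) (eand (Call holds_at_proc [lit 1, enull, Var 0])
       (Call check_roots_proc [Var 0, Var 1, Var 0]))) (lit 1)"

section \<open>Bodies for the motion of cars and the timed word\<close>

definition shapes_body where
  "shapes_body = Cond (IsNode (Var 0))
     (MkNode (elist [Fst (Fst (Var 0)),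
        triple (el2 (Fst (Var 0))) (el4 (Fst (Var 0))) (el5 (Fst (Var 0)) /.. lit 2),
        triple (el2 (Fst (Var 0)) +.. (el4 (Fst (Var 0)) *.. el4 (Fst (Var 0)) /.. Var 1 +..
            el1 (Fst (Var 0))))
          (el4 (Fst (Var 0)) +.. lit 2 *.. el4 (Fst (Var 0)) *.. el5 (Fst (Var 0)) /.. Var 1)
          (el5 (Fst (Var 0)) /.. lit 2 +.. el5 (Fst (Var 0)) *.. el5 (Fst (Var 0)) /.. Var 1),
        el6 (Fst (Var 0)), el7 (Fst (Var 0))])
       (Call shapes_proc [Snd (Var 0), Var 1])) MkLeaf"

definition advance_body where
  "advance_body = elist [Fst (Var 1), el1 (Var 1),
     el2 (Var 1) +.. el4 (Var 1) *.. Var 0 +.. el5 (Var 1) *.. Var 0 *.. Var 0 /.. lit 2,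
     el3 (Var 1), el4 (Var 1) +.. el5 (Var 1) *.. Var 0, el5 (Var 1), el6 (Var 1), el7 (Var 1)]"

text \<open>The new state is assembled component by component. Symbols with tags 2 and 3 have no
  second argument, so \<open>el2 (Var 0)\<close> is read only behind tests that exclude
  them.\<close>

definition act_body where
  "act_body = Cond (Fst (Var 0) <.. lit 1) (Var 1)
     (Cond (el1 (Var 0) =.. Fst (Var 1))
       (elist [Fst (Var 1), el1 (Var 1), el2 (Var 1), el3 (Var 1), el4 (Var 1),
          Cond (Fst (Var 0) <.. lit 5) (el5 (Var 1)) (el2 (Var 0)),
          Cond (Fst (Var 0) <.. lit 2) (el6 (Var 1))
            (Cond (Fst (Var 0) <.. lit 3) (eappend (el6 (Var 1)) (el7 (Var 1)))
            (Cond (Fst (Var 0) <.. lit 4) (el6 (Var 1))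
            (Cond (Fst (Var 0) <.. lit 5) (elist [el2 (Var 0)]) (el6 (Var 1))))),
          Cond (Fst (Var 0) <.. lit 2) (elist [el2 (Var 0)])
            (Cond (Fst (Var 0) <.. lit 4) MkLeaf (el7 (Var 1)))])
       (Var 1))"

definition step_body where
  "step_body = Cond (IsNode (Var 2))
     (MkNode (Call act_proc [Var 0, Call advance_proc [Var 1, Fst (Var 2)]]) (Call step_proc [Var 0, Var 1, Snd (Var 2)]))
     MkLeaf"

definition segment_body where
  "segment_body = Call qe_proc [el7 (Var 1), el6 (Var 1), el4 (Var 1), el5 (Var 1),
     ecomb (el1 (Call find_proc [Var 0, el3 (Var 1)])) (triple (el1 (Var 1)) (lit 0) (lit 0)) (lit 1),
     ecomb (el1 (Call find_proc [Var 0, el3 (Var 1)])) (triple (el2 (Var 1)) (lit 0) (lit 0)) (lit 1),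
     Var 0]"

definition solve_body where
  "solve_body = Cond (IsNode (Var 2))
     (eand (Call check_interval_proc [Call segment_proc [Call shapes_proc [Var 1, Fst (Var 3)], Var 3], Snd (Fst (Var 2)) -.. Var 0])
       (Call solve_proc [Snd (Fst (Var 2)),
         Call step_proc [Fst (Fst (Var 2)), Snd (Fst (Var 2)) -.. Var 0, Var 1], Snd (Var 2), Var 3]))
     (Call holds_at_proc [lit 0, enull, Call segment_proc [Call shapes_proc [Var 1, Fst (Var 3)], Var 3]])"

text \<open>A procedure of its own in place of a local definition: the list is used twice. The
  constant 1/2 is a quotient because literals are integers.\<close>

definition mids_body where
  "mids_body = Call pairs_proc [Var 0, Var 0, lit 1 /.. lit 2]"

text \<open>\<open>Var 0\<close> is the list of cars, lane count, \<open>b\<^sub>m\<^sub>a\<^sub>x\<close>, view, valuation, timed word and formula. The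
  view is turned into offsets from the rear of its owner.\<close>

definition main_body where
  "main_body = Call solve_proc [lit 0, Fst (Var 0), el5 (Var 0),
     elist [el2 (Var 0),
       el2 (el3 (Var 0)) -.. Fst (el1 (Call find_proc [Call shapes_proc [Fst (Var 0), el2 (Var 0)], el4 (el3 (Var 0))])),
       el3 (el3 (Var 0)) -.. Fst (el1 (Call find_proc [Call shapes_proc [Fst (Var 0), el2 (Var 0)], el4 (el3 (Var 0))])),
       el4 (el3 (Var 0)), Fst (el3 (Var 0)), el1 (el3 (Var 0)), el4 (Var 0), el6 (Var 0)]]"

definition prog :: program where
  "prog = [main_body, comb_body, less_body, append_body, pairs1_body, pairs_body, offsets_body,
     ends_body, lookup_body, find_body, mem_body, vacant_body, cover_body, qe_body, ex_body,
     hchop_body, vchop_body, surd_body, pos_at_body, pos_after_body, holds_at_body,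
     check_sample_body, check_roots_body, check_interval_body, shapes_body, advance_body, act_body,
     step_body, segment_body, solve_body, mids_body]"

text \<open>Kept out of the simpset, as a recursive body would be unfolded forever. A proof unfolds
  the call at hand by \<open>subst\<close> and leaves inner recursive calls to the induction
  hypothesis.\<close>

lemma call_prog:
  "call prog 0 xs = den prog xs main_body"
  "call prog comb_proc xs = den prog xs comb_body"
  "call prog less_proc xs = den prog xs less_body"
  "call prog append_proc xs = den prog xs append_body"
  "call prog pairs1_proc xs = den prog xs pairs1_body"
  "call prog pairs_proc xs = den prog xs pairs_body"
  "call prog offsets_proc xs = den prog xs offsets_body"
  "call prog ends_proc xs = den prog xs ends_body"
  "call prog lookup_proc xs = den prog xs lookup_body"
  "call prog find_proc xs = den prog xs find_body"
  "call prog mem_proc xs = den prog xs mem_body"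
  "call prog vacant_proc xs = den prog xs vacant_body"
  "call prog cover_proc xs = den prog xs cover_body"
  "call prog qe_proc xs = den prog xs qe_body"
  "call prog ex_proc xs = den prog xs ex_body"
  "call prog hchop_proc xs = den prog xs hchop_body"
  "call prog vchop_proc xs = den prog xs vchop_body"
  "call prog surd_proc xs = den prog xs surd_body"
  "call prog pos_at_proc xs = den prog xs pos_at_body"
  "call prog pos_after_proc xs = den prog xs pos_after_body"
  "call prog holds_at_proc xs = den prog xs holds_at_body"
  "call prog check_sample_proc xs = den prog xs check_sample_body"
  "call prog check_roots_proc xs = den prog xs check_roots_body"
  "call prog check_interval_proc xs = den prog xs check_interval_body"
  "call prog shapes_proc xs = den prog xs shapes_body"
  "call prog advance_proc xs = den prog xs advance_body"
  "call prog act_proc xs = den prog xs act_body"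
  "call prog step_proc xs = den prog xs step_body"
  "call prog segment_proc xs = den prog xs segment_body"
  "call prog solve_proc xs = den prog xs solve_body"
  "call prog mids_proc xs = den prog xs mids_body"
  by (simp_all add: call_def prog_def)

subsection \<open>What the procedures compute\<close>

lemma call_comb [simp]:
  "call prog comb_proc [quad_data p, quad_data q, Atom k] = Some (quad_data (quad_comb k p q))"
  by (cases p; cases q) (simp add: call_prog den_simps comb_body_def)

lemma call_less [simp]:
  "call prog less_proc [quad_data p, quad_data q] = Some (qf_data (qless p q))"
  by (cases p; cases q) (simp add: call_prog den_simps less_body_def)

lemma call_append: "call prog append_proc [list_data xs, list_data ys] = Some (list_data (xs @ ys))"
proof (induction xs)
  case Nil
  have "\<nexists>y z. (Leaf :: real data) = Node y z" by simp
  then show ?case by (subst call_prog) (simp add: den_simps append_body_def)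
next
  case (Cons x xs)
  then show ?case by (subst call_prog) (simp add: den_simps append_body_def)
qed

lemma call_append' [simp]:
  "call prog append_proc [quads_data ps, quads_data qs] = Some (quads_data (ps @ qs))"
  "call prog append_proc [ints_data ls, ints_data ms] = Some (ints_data (ls @ ms))"
  by (simp_all add: quads_data_def ints_data_def call_append)

lemma call_pairs1 [simp]:
  "call prog pairs1_proc [quad_data x, quads_data ys, Atom k] = Some (quads_data (map (quad_comb k x) ys))"
  by (induction ys) (subst call_prog, simp add: den_simps pairs1_body_def)+

lemma call_pairs [simp]:
  "call prog pairs_proc [quads_data xs, quads_data ys, Atom k] = Some (quads_data (pairs k xs ys))"
  by (induction xs) (subst call_prog, simp add: den_simps pairs_body_def)+

lemma call_offsets [simp]: "call prog offsets_proc [mlsl_data \<phi>] = Some (quads_data (offsets \<phi>))"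
  by (induction \<phi>) (subst call_prog, simp add: den_simps offsets_body_def tagged_def nat_data_def)+

lemma call_ends [simp]: "call prog ends_proc [shapes_data G] = Some (quads_data (ends G))"
proof (induction G)
  case Nil
  show ?case by (subst call_prog) (simp add: den_simps ends_body_def)
next
  case (Cons s G)
  then show ?case by (cases s) (subst call_prog, simp add: den_simps ends_body_def)
qed

lemma call_lookup [simp]:
  "call prog lookup_proc [bindings_data N, cvar_data c] = Some (nat_data (lookup N c))"
proof (induction N)
  case Nil
  show ?case by (subst call_prog) (simp add: den_simps lookup_body_def nat_data_def)
next
  case (Cons x N)
  then show ?case
    by (cases x) (subst call_prog, auto simp: den_simps lookup_body_def cvar_data_code nat_data_def
      simp flip: cvar_code_eq_iff)
qed

lemma call_find [simp]:
  "call prog find_proc [shapes_data G, nat_data C] = Some (shape_data (find_shape G C))"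
proof (induction G)
  case Nil
  show ?case by (subst call_prog) (simp add: den_simps find_body_def nat_data_def)
next
  case (Cons s G)
  then show ?case
    by (cases s) (subst call_prog, auto simp: den_simps find_body_def nat_data_def)
qed

lemma call_mem [simp]: "call prog mem_proc [int_data l, ints_data ls] = Some (truth (l \<in> set ls))"
proof (induction ls)
  case Nil
  show ?case by (subst call_prog) (simp add: den_simps mem_body_def truth_def)
next
  case (Cons m ls)
  then show ?case
    by (subst call_prog) (auto simp: den_simps mem_body_def truth_def int_data_def)
qed

lemma shape_data_eq:
  "shape_data s = list_data [nat_data (car_id s), quad_data (rear s), quad_data (front s),
     ints_data (reserved s), ints_data (claimed s)]"
  by (cases s) simp

lemma call_vacant [simp]:
  "call prog vacant_proc [shapes_data G, int_data l, quad_data lo, quad_data hi] =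
     Some (qf_data (qvacant G l lo hi))"
proof (induction G)
  case Nil
  show ?case by (subst call_prog) (simp add: den_simps vacant_body_def qtrue_def)
next
  case (Cons s G)
  then show ?case
    by (subst call_prog) (simp add: den_simps vacant_body_def shape_data_eq del: shape_data.simps)
qed

lemma call_cover [simp]:
  "call prog cover_proc [int_data l, int_data n, shape_data s, ints_data ls, quad_data lo, quad_data hi] =
     Some (qf_data (qcover l n s ls lo hi))"
proof -
  have [simp]: "call prog mem_proc [Atom (real_of_int l), ints_data ls] = Some (truth (l \<in> set ls))" for l
    using call_mem[of l ls] by (simp add: int_data_def)
  show ?thesis
  by (subst call_prog) (auto simp: den_simps cover_body_def shape_data_eq int_data_def qcover_def
      qle_def qfalse_def truth_def simp del: shape_data.simps)
qed

lemma call_mids [simp]: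
  "call prog mids_proc [quads_data K] = Some (quads_data (pairs (1/2) K K))"
  by (simp add: call_prog(31) den_simps mids_body_def)

lemma call_surd [simp]: "call prog surd_proc [Atom a, Atom b, Atom D] = Some (truth (surd_pos a b D))"
  by (subst call_prog) (auto simp: den_simps surd_body_def surd_pos_def truth_def)

lemma call_pos_at [simp]: "call prog pos_at_proc [quad_data p, quad_data s] = Some (truth (pos_at p s))"
  by (cases p; cases s) (subst call_prog, simp add: den_simps pos_at_body_def)

text \<open>A triple built by the program appears as bare nested nodes rather than as
  \<open>quad_data\<close>; the fact is needed in this form too for the simplifier to apply
  it.\<close>

lemma call_pos_at' [simp]:
  "call prog pos_at_proc [Node (Atom a) (Node (Atom b) (Atom c)), quad_data s] = Some (truth (pos_at (a, b, c) s))"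
  using call_pos_at[of "(a, b, c)"] by simp

lemma call_pos_after [simp]: "call prog pos_after_proc [quad_data p, quad_data s] = Some (truth (pos_after p s))"
  by (cases p) (subst call_prog, auto simp: den_simps pos_after_body_def truth_def)

lemma call_holds_at [simp]:
  "call prog holds_at_proc [truth after, quad_data s, qf_data \<alpha>] = Some (truth (holds_at after s \<alpha>))"
proof (induction \<alpha>)
  case (Pos p)
  then show ?case
    by (cases p) (subst call_prog, simp add: den_simps holds_at_body_def del: call_pos_at
      add: call_pos_at[of "(x,y,z)" for x y z, simplified] call_pos_after[of "(x,y,z)" for x y z, simplified])
qed (subst call_prog, auto simp: den_simps holds_at_body_def truth_def)+

lemma call_holds_at' [simp]:
  "call prog holds_at_proc [Atom 0, quad_data s, qf_data \<alpha>] = Some (truth (holds_at False s \<alpha>))"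
  "call prog holds_at_proc [Atom 1, quad_data s, qf_data \<alpha>] = Some (truth (holds_at True s \<alpha>))"
  using call_holds_at[of False] call_holds_at[of True] by (simp_all add: truth_def)


lemma call_check_sample [simp]:
  "call prog check_sample_proc [qf_data \<alpha>, Atom b, quad_data s] = Some (truth (check_sample \<alpha> b s))"
proof -
  obtain x e D where s: "s = (x, e, D)" by (cases s)
  have [simp]: "snd_data (quad_data s) = Some (Node (Atom e) (Atom D))" by (simp add: s)
  have "check_sample \<alpha> b s \<longleftrightarrow> (\<not> D < 0 \<and> pos_at (0, 1, 0) s \<and> pos_at (b, -1, 0) s \<longrightarrow>
      holds_at False s \<alpha> \<and> holds_at True s \<alpha>)"
    by (simp add: s not_less del: pos_at.simps)
  then show ?thesis
    by (subst call_prog) (auto simp: den_simps check_sample_body_def truth_def)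
qed

lemma call_check_roots [simp]:
  "call prog check_roots_proc [qf_data \<alpha>, Atom b, qf_data \<beta>] = Some (truth (check_roots \<alpha> b \<beta>))"
proof (induction \<beta>)
  case (Pos p)
  have [simp]: "call prog check_sample_proc [qf_data \<alpha>, Atom b, Node (Atom x) (Node (Atom y) (Atom z))] =
      Some (truth (check_sample \<alpha> b (x, y, z)))" for x y z
    using call_check_sample[of \<alpha> b "(x, y, z)"] by simp
  show ?case
    by (cases p) (subst call_prog, auto simp: den_simps check_roots_body_def truth_def
       simp del: check_sample.simps)
qed (subst call_prog, auto simp: den_simps check_roots_body_def truth_def)+

lemma call_check_interval [simp]:
  "call prog check_interval_proc [qf_data \<alpha>, Atom b] = Some (truth (check_interval \<alpha> b))"
proof -
  have [simp]: "call prog holds_at_proc [Atom 0, Node (Atom 0) (Node (Atom 0) (Atom 0)), qf_data \<alpha>] =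
      Some (truth (holds_at False (0, 0, 0) \<alpha>))"
    "call prog holds_at_proc [Atom 1, Node (Atom 0) (Node (Atom 0) (Atom 0)), qf_data \<alpha>] =
      Some (truth (holds_at True (0, 0, 0) \<alpha>))"
    using call_holds_at'[of "(0, 0, 0)"] by simp_all
  show ?thesis
    by (subst call_prog) (auto simp: den_simps check_interval_body_def check_interval_def truth_def)
qed

lemma call_shapes [simp]:
  "call prog shapes_proc [states_data S, Atom b] = Some (shapes_data (map (shape_of b) S))"
proof (induction S)
  case Nil
  show ?case by (subst call_prog) (simp add: den_simps shapes_body_def)
next
  case (Cons s S)
  then show ?case by (cases s) (subst call_prog, simp add: den_simps shapes_body_def)
qed

lemma call_advance [simp]:
  "call prog advance_proc [Atom z, car_state_data s] = Some (car_state_data (advance z s))"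
  by (cases s) (subst call_prog, simp add: den_simps advance_body_def)

lemma call_act [simp]:
  "call prog act_proc [symbol_data \<sigma>, car_state_data s] = Some (car_state_data (act \<sigma> s))"
proof (cases s)
  case s: (CarState C p x y v a R K)
  show ?thesis
  proof (cases \<sigma>)
    case Dagger
    then show ?thesis
      by (subst call_prog) (simp add: den_simps act_body_def tagged_def nat_data_def)
  next
    case (Act b)
    then show ?thesis unfolding s
      by (cases b) (subst call_prog, simp add: den_simps act_body_def tagged_def nat_data_def)+
  qed
qed

lemma call_step [simp]:
  "call prog step_proc [symbol_data \<sigma>, Atom z, states_data S] =
     Some (states_data (map (\<lambda>s. act \<sigma> (advance z s)) S))"
  by (induction S) (subst call_prog, simp add: den_simps step_body_def)+

text \<open>Translation and loop call each other. The assumption is the induction hypothesis of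
  \<open>call_qe\<close> for the smaller formula, so the loop can be treated first. The loop
  consumes G' while the translation keeps the whole list G.\<close>

lemma call_ex:
  assumes "\<And>N. call prog qe_proc [mlsl_data \<phi>, bindings_data N, int_data l, int_data n, quad_data lo,
     quad_data hi, shapes_data G] = Some (qf_data (qe G \<phi> N l n lo hi))"
  shows "call prog ex_proc [shapes_data G', cvar_data c, mlsl_data \<phi>, bindings_data N, int_data l,
     int_data n, quad_data lo, quad_data hi, shapes_data G] =
     Some (qf_data (qdisj (map (\<lambda>s. qe G \<phi> ((c, car_id s) # N) l n lo hi) G')))"
proof (induction G')
  case Nil
  show ?case by (subst call_prog) (simp add: den_simps ex_body_def qfalse_def)
next
  case (Cons s G')
  have "call prog qe_proc [mlsl_data \<phi>, Node (Node (cvar_data c) (nat_data (car_id s))) (bindings_data N),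
      int_data l, int_data n, quad_data lo, quad_data hi, shapes_data G] =
      Some (qf_data (qe G \<phi> ((c, car_id s) # N) l n lo hi))"
    using assms[of "(c, car_id s) # N"] by simp
  with Cons show ?case
    by (subst call_prog) (simp add: den_simps ex_body_def qor_def shape_data_eq del: shape_data.simps)
qed

lemma call_hchop:
  assumes "\<And>lo hi. call prog qe_proc [mlsl_data \<phi>, bindings_data N, int_data l, int_data n, quad_data lo,
     quad_data hi, shapes_data G] = Some (qf_data (qe G \<phi> N l n lo hi))"
    and "\<And>lo hi. call prog qe_proc [mlsl_data \<psi>, bindings_data N, int_data l, int_data n, quad_data lo,
     quad_data hi, shapes_data G] = Some (qf_data (qe G \<psi> N l n lo hi))"
  shows "call prog hchop_proc [quads_data T, mlsl_data \<phi>, mlsl_data \<psi>, bindings_data N, int_data l,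
     int_data n, quad_data lo, quad_data hi, shapes_data G] =
     Some (qf_data (qdisj (map (\<lambda>s. QAnd (QAnd (qle lo s) (qle s hi))
       (QAnd (qe G \<phi> N l n lo s) (qe G \<psi> N l n s hi))) T)))"
proof (induction T)
  case Nil
  show ?case by (subst call_prog) (simp add: den_simps hchop_body_def qfalse_def)
next
  case (Cons s T)
  then show ?case
    by (subst call_prog) (simp add: den_simps hchop_body_def qor_def qle_def assms)
qed

lemma call_vchop:
  assumes "\<And>l n. call prog qe_proc [mlsl_data \<phi>, bindings_data N, int_data l, int_data n, quad_data lo,
     quad_data hi, shapes_data G] = Some (qf_data (qe G \<phi> N l n lo hi))"
    and "\<And>l n. call prog qe_proc [mlsl_data \<psi>, bindings_data N, int_data l, int_data n, quad_data lo,
     quad_data hi, shapes_data G] = Some (qf_data (qe G \<psi> N l n lo hi))"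
  shows "call prog vchop_proc [int_data k, mlsl_data \<phi>, mlsl_data \<psi>, bindings_data N, int_data l,
     int_data n, quad_data lo, quad_data hi, shapes_data G] =
     Some (qf_data (qdisj (map (\<lambda>m. QAnd (qe G \<phi> N l m lo hi) (qe G \<psi> N (m + 1) n lo hi)) [k..n])))"
\<comment> \<open>Induction on the number of chop lanes still to be visited.\<close>
proof (induction "nat (n + 1 - k)" arbitrary: k)
  case 0
  then show ?case
    by (subst call_prog) (simp add: den_simps vchop_body_def qfalse_def int_data_def)
next
  case (Suc d)
  have IH: "call prog vchop_proc [int_data (k + 1), mlsl_data \<phi>, mlsl_data \<psi>, bindings_data N, int_data l,
     int_data n, quad_data lo, quad_data hi, shapes_data G] =
     Some (qf_data (qdisj (map (\<lambda>m. QAnd (qe G \<phi> N l m lo hi) (qe G \<psi> N (m + 1) n lo hi)) [k + 1..n])))"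
    using Suc.hyps by (intro Suc.hyps(1)) simp
  have "k \<le> n" using Suc.hyps(2) by simp
  then show ?case
    using IH assms(1)[of l k] assms(2)[of "k + 1" n]
    by (subst call_prog)
      (simp add: den_simps vchop_body_def qor_def int_data_def upto_rec1 not_less)
qed

lemma call_qe [simp]:
  "call prog qe_proc [mlsl_data \<phi>, bindings_data N, int_data l, int_data n, quad_data lo, quad_data hi,
     shapes_data G] = Some (qf_data (qe G \<phi> N l n lo hi))"
proof (induction \<phi> arbitrary: N l n lo hi)
  case (Same c d)
  show ?case
    by (subst call_prog) (auto simp: den_simps qe_body_def tagged_def qtrue_def qfalse_def nat_data_def
      call_lookup[unfolded nat_data_def])
next
  case Free
  have [simp]: "call prog vacant_proc [shapes_data G, Atom (real_of_int l), quad_data lo, quad_data hi] =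
     Some (qf_data (qvacant G l lo hi))" for l
    using call_vacant[of G l] by (simp add: int_data_def)
  show ?case
    by (subst call_prog) (auto simp: den_simps qe_body_def tagged_def nat_data_def int_data_def qfalse_def)
next
  case (Re c)
  show ?case using call_cover[of l n "find_shape G (lookup N c)" "reserved (find_shape G (lookup N c))" lo hi]
    by (subst call_prog) (simp add: den_simps qe_body_def tagged_def nat_data_def[of 2]
      shape_data_eq Let_def del: shape_data.simps call_cover)
next
  case (Cl c)
  show ?case using call_cover[of l n "find_shape G (lookup N c)" "claimed (find_shape G (lookup N c))" lo hi]
    by (subst call_prog) (simp add: den_simps qe_body_def tagged_def nat_data_def[of 3]
      shape_data_eq Let_def del: shape_data.simps call_cover)
next
  case (LenEq q)
  have [simp]: "call prog comb_proc [quad_data lo, Node (Atom a) (Node (Atom b) (Atom c)), Atom k] =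
      Some (quad_data (quad_comb k lo (a, b, c)))" for a b c k
    using call_comb[of lo "(a, b, c)"] by simp
  show ?case
    by (subst call_prog) (simp add: den_simps qe_body_def tagged_def nat_data_def qle_def Let_def)
next
  case (Neg \<phi>)
  then show ?case
    by (subst call_prog) (simp add: den_simps qe_body_def tagged_def nat_data_def)
next
  case (Conj \<phi> \<psi>)
  then show ?case
    by (subst call_prog) (simp add: den_simps qe_body_def tagged_def nat_data_def)
next
  case (Ex c \<phi>)
  show ?case using call_ex[OF Ex, where c = "CVar c"]
    by (subst call_prog) (simp add: den_simps qe_body_def tagged_def nat_data_def[of 7])
next
  case (HChop \<phi> \<psi>)
  have [simp]: "call prog pairs_proc [Node (quad_data lo) (Node (quad_data hi) (quads_data (ends G))), quads_data qs,
      Atom k] = Some (quads_data (pairs k (lo # hi # ends G) qs))" for qs k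
    using call_pairs[of "lo # hi # ends G"] by simp
  show ?case using call_hchop[OF HChop]
    by (subst call_prog) (simp add: den_simps qe_body_def tagged_def nat_data_def chop_points_def Let_def)
next
  case (VChop \<psi> \<phi>)
  show ?case using call_vchop[OF VChop(2) VChop(1), where k = "l - 1"] VChop
    by (subst call_prog) (simp add: den_simps qe_body_def tagged_def nat_data_def int_data_def)
qed

definition context_data :: "real \<Rightarrow> real \<Rightarrow> real \<Rightarrow> car \<Rightarrow> lane \<Rightarrow> lane \<Rightarrow> (cvar \<times> car) list \<Rightarrow> mlsl \<Rightarrow> real data"
  where "context_data b rl rh E l n N \<phi> = list_data [Atom b, Atom rl, Atom rh, nat_data E, int_data l,
    int_data n, bindings_data N, mlsl_data \<phi>]"

lemma call_segment [simp]:
  "call prog segment_proc [shapes_data (map (shape_of b) S), context_data b rl rh E l n N \<phi>] =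
     Some (qf_data (segment b rl rh E l n N \<phi> S))"
proof -
  have [simp]: "call prog comb_proc [quad_data p, Node (Atom a) (Node (Atom b) (Atom c)), Atom k] =
      Some (quad_data (quad_comb k p (a, b, c)))" for p a b c k
    using call_comb[of p "(a, b, c)"] by simp
  show ?thesis
    by (subst call_prog) (simp add: den_simps segment_body_def context_data_def segment_def Let_def
      shape_data_eq del: shape_data.simps)
qed

lemma call_solve [simp]:
  "call prog solve_proc [Atom \<tau>, states_data S, word_data w, context_data b rl rh E l n N \<phi>] =
     Some (truth (solve (segment b rl rh E l n N \<phi>) \<tau> S w))"
proof (induction w arbitrary: \<tau> S)
  have [simp]: "fst_data (context_data b rl rh E l n N \<phi>) = Some (Atom b)"
    by (simp add: context_data_def)
  {
    case Nil
    have [simp]: "call prog holds_at_proc [Atom 0, Node (Atom 0) (Node (Atom 0) (Atom 0)), qf_data \<alpha>] =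
        Some (truth (holds_at False (0, 0, 0) \<alpha>))" for \<alpha>
      using call_holds_at'[of "(0, 0, 0)"] by simp
    show ?case by (subst call_prog) (simp add: den_simps solve_body_def)
  next
    case (Cons x w)
    then show ?case
      by (cases x) (subst call_prog, auto simp: den_simps solve_body_def truth_def)
  }
qed

definition init_states :: "problem \<Rightarrow> car_state list" where
  "init_states p = (let TS = init_snapshot p in
     map (\<lambda>C. CarState C (plen p C) (pos TS C) (len TS C) (spd TS C) (acc TS C)
       (sorted_list_of_set (res TS C)) (sorted_list_of_set (clm TS C)))
     (sorted_list_of_set (cars p)))"

definition init_bindings :: "problem \<Rightarrow> (cvar \<times> car) list" where
  "init_bindings p = map (\<lambda>c. (c, valuation p c)) (mlsl_vars (formula p))"

definition decide :: "problem \<Rightarrow> bool" where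
  "decide p =
     (let V = init_view p;
          r = fst (rear (find_shape (map (shape_of (bmax p)) (init_states p)) (owner V)))
      in solve (segment (bmax p) (ext_lo V - r) (ext_hi V - r) (owner V) (lane_lo V) (lane_hi V)
           (init_bindings p) (formula p)) 0 (init_states p) (tword p))"

lemma problem_data_eq:
  "problem_data p = list_data [states_data (init_states p), nat_data (lane_count p), Atom (bmax p),
     view_data (init_view p), bindings_data (init_bindings p), word_data (tword p),
     mlsl_data (formula p)]"
proof -
  have "cars_data (cars p) (plen p) (init_snapshot p) = states_data (init_states p)"
    by (simp add: cars_data_def states_data_def init_states_def Let_def lanes_data_def ints_data_def
        comp_def del: list_data_simps(3-) list_data_simps(2) cong: map_cong)
  moreover have "valuation_data (mlsl_vars (formula p)) (valuation p) = bindings_data (init_bindings p)"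
    by (simp add: valuation_data_def bindings_data_def init_bindings_def comp_def)
  ultimately show ?thesis by (simp add: problem_data_def)
qed

lemma call_main: "call prog 0 [problem_data p] = Some (truth (decide p))"
proof -
  let ?s = "find_shape (map (shape_of (bmax p)) (init_states p)) (owner (init_view p))"
  obtain r r' r'' where r: "rear ?s = (r, r', r'')" by (cases "rear ?s")
  show ?thesis
    using call_solve[of 0 "init_states p" "tword p" "bmax p" "ext_lo (init_view p) - r"
      "ext_hi (init_view p) - r" "owner (init_view p)" "lane_lo (init_view p)" "lane_hi (init_view p)"
      "init_bindings p" "formula p"]
    by (subst call_prog) (simp add: den_simps main_body_def problem_data_eq view_data_def shape_data_eq
       context_data_def decide_def Let_def r del: shape_data.simps)
qed

lemma computes_decide: "computes prog (problem_data p) (truth (decide p))"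
proof -
  have "den prog [problem_data p] (Call 0 [Var 0]) = Some (truth (decide p))"
    by (simp add: den_simps call_main)
  then show ?thesis by (simp add: computes_def)
qed

section \<open>Correctness of quantifier elimination\<close>

definition agree :: "real \<Rightarrow> real \<Rightarrow> real \<Rightarrow> real \<Rightarrow> bool" where
  "agree a b a' b' \<longleftrightarrow> (a < b \<longleftrightarrow> a' < b') \<and> (b < a \<longleftrightarrow> b' < a')"

text \<open>The type records where both borders lie relative to the shifted car ends, and how the
  length compares with each offset. The ends B are common to both intervals, as only the view
  changes.\<close>

definition same_type :: "real set \<Rightarrow> real set \<Rightarrow> real \<Rightarrow> real \<Rightarrow> real \<Rightarrow> real \<Rightarrow> bool" where
  "same_type B D x y x' y' \<longleftrightarrow>
     (\<forall>b\<in>B. \<forall>d\<in>D. agree x (b + d) x' (b + d) \<and> agree y (b + d) y' (b + d)) \<and>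
     (\<forall>d\<in>D. agree y (x + d) y' (x' + d))"

definition sumset :: "real set \<Rightarrow> real set" where
  "sumset D = {a + b |a b. a \<in> D \<and> b \<in> D}"

lemma same_type_refl: "same_type B D x y x y"
  by (simp add: same_type_def agree_def)

lemma same_type_sym: "same_type B D x y x' y' \<Longrightarrow> same_type B D x' y' x y"
  unfolding same_type_def agree_def by blast

lemma same_type_mono: "same_type B D x y x' y' \<Longrightarrow> D' \<subseteq> D \<Longrightarrow> same_type B D' x y x' y'"
  unfolding same_type_def by blast

text \<open>If s is one of the values k i, take i twice. Otherwise s lies strictly between its
  nearest neighbours k i and k j, which exist by the bounds on s. Both families are ordered alike,
  so no value of k' falls strictly between k' i and k' j, and their midpoint occupies the
  corresponding gap.\<close>

lemma interleave:
  fixes k k' :: "'i \<Rightarrow> real"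
  assumes fin: "finite J" and ag: "\<And>i j. i \<in> J \<Longrightarrow> j \<in> J \<Longrightarrow> agree (k i) (k j) (k' i) (k' j)"
    and "i0 \<in> J" "j0 \<in> J" "k i0 \<le> s" "s \<le> k j0"
  shows "\<exists>i\<in>J. \<exists>j\<in>J. \<forall>m\<in>J. agree s (k m) ((k' i + k' j) / 2) (k' m)"
proof (cases "\<exists>i\<in>J. k i = s")
  case True
  then obtain i where "i \<in> J" "k i = s" by blast
  with ag show ?thesis by (intro bexI[of _ i] ballI) auto
next
  case False
  let ?L = "{m \<in> J. k m < s}" and ?U = "{m \<in> J. s < k m}"
  have "i0 \<in> ?L" "j0 \<in> ?U" using assms False by force+
  with fin have M: "Max (k ` ?L) \<in> k ` ?L" "Min (k ` ?U) \<in> k ` ?U"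
    by (intro Max_in Min_in; auto)+
  obtain i where i: "Max (k ` ?L) = k i" "i \<in> ?L" by (rule imageE[OF M(1)])
  obtain j where j: "Min (k ` ?U) = k j" "j \<in> ?U" by (rule imageE[OF M(2)])
  have maxi: "k m \<le> k i" if "m \<in> ?L" for m
    using that fin unfolding i(1)[symmetric] by (intro Max_ge) auto
  have minj: "k j \<le> k m" if "m \<in> ?U" for m
    using that fin unfolding j(1)[symmetric] by (intro Min_le) auto
  have "k i < k j" using i(2) j(2) by auto
  then have ij: "k' i < k' j" using ag[of i j] i(2) j(2) by (auto simp: agree_def)
  have "agree s (k m) ((k' i + k' j) / 2) (k' m)" if "m \<in> J" for m
  proof (cases "k m < s")
    case True
    with maxi that have "k m \<le> k i" by auto
    then have "k' m \<le> k' i" using ag[of i m] i(2) that unfolding agree_def by force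
    with ij True show ?thesis unfolding agree_def by auto
  next
    case False
    with \<open>\<not> (\<exists>i\<in>J. k i = s)\<close> that have *: "s < k m" by force
    with minj that have "k j \<le> k m" by auto
    then have "k' j \<le> k' m" using ag[of m j] j(2) that unfolding agree_def by force
    with ij * show ?thesis unfolding agree_def by auto
  qed
  with i(2) j(2) show ?thesis by blast
qed

text \<open>The back-and-forth step. To place a point s of the first interval in the second, all
  ends shifted by D must be ordered alike in both; comparing z + d with w + e means comparing z with
  w + (e - d), which the finer type over \<open>sumset D\<close> decides. With equal intervals it
  says that the candidates are complete.\<close>

lemma chop_point_transfer:
  fixes B D :: "real set"
  assumes fin: "finite B" "finite D" and D: "0 \<in> D" "\<forall>d\<in>D. - d \<in> D"
    and st: "same_type B (sumset D) x y x' y'" and s: "x \<le> s" "s \<le> y"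
  defines "K \<equiv> {z + d |z d. z \<in> B \<union> {x', y'} \<and> d \<in> D}"
  shows "\<exists>k1\<in>K. \<exists>k2\<in>K. x' \<le> (k1 + k2) / 2 \<and> (k1 + k2) / 2 \<le> y' \<and>
    same_type B D x s x' ((k1 + k2) / 2) \<and> same_type B D s y ((k1 + k2) / 2) y'"
proof -
  \<comment> \<open>Names for shifted ends that make sense in both intervals: \<open>Inl b\<close>
    is a car end, \<open>Inr False\<close> the left border and \<open>Inr True\<close> the right
    one.\<close>
  define val :: "real \<Rightarrow> real \<Rightarrow> (real + bool) \<times> real \<Rightarrow> real" where
    "val u v = (\<lambda>(i, d). (case i of Inl b \<Rightarrow> b | Inr c \<Rightarrow> if c then v else u) + d)" for u v
  define J :: "((real + bool) \<times> real) set" where "J = (Inl ` B \<union> range Inr) \<times> D"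
  have "finite J" using fin by (simp add: J_def)
  have diff: "d - e \<in> sumset D" if "d \<in> D" "e \<in> D" for d e
    using bspec[OF D(2) that(2)] that(1) unfolding sumset_def by (metis (mono_tags, lifting) add_uminus_conv_diff mem_Collect_eq)
  have ag: "agree (val x y i) (val x y j) (val x' y' i) (val x' y' j)" if ij: "i \<in> J" "j \<in> J" for i j
  proof -
    obtain p d q e where pq: "i = (p, d)" "j = (q, e)" by fastforce
    have mem: "d \<in> D" "e \<in> D" "p \<in> Inl ` B \<union> range Inr" "q \<in> Inl ` B \<union> range Inr"
      using ij by (auto simp: pq J_def)
    have *: "d - e \<in> sumset D" "e - d \<in> sumset D" using diff mem by auto
    have xy: "agree y (x + (d - e)) y' (x' + (d - e))" "agree y (x + (e - d)) y' (x' + (e - d))"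
      using st * unfolding same_type_def by blast+
    have B: "agree x (b + (d - e)) x' (b + (d - e))" "agree x (b + (e - d)) x' (b + (e - d))"
      "agree y (b + (d - e)) y' (b + (d - e))" "agree y (b + (e - d)) y' (b + (e - d))"
      if "b \<in> B" for b using st * that unfolding same_type_def by blast+
    consider b c where "p = Inl b" "q = Inl c" "b \<in> B" "c \<in> B" | b c where "p = Inl b" "q = Inr c" "b \<in> B"
      | b c where "p = Inr b" "q = Inl c" "c \<in> B" | b c where "p = Inr b" "q = Inr c"
      using mem by auto
    then show ?thesis
    proof cases
      case 1
      then show ?thesis by (simp add: pq val_def agree_def)
    next
      case 2
      then show ?thesis using B[OF 2(3)] unfolding pq val_def agree_def by (cases c) (simp, argo)+
    next
      case 3
      then show ?thesis using B[OF 3(3)] unfolding pq val_def agree_def by (cases b) (simp, argo)+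
    next
      case 4
      then show ?thesis using xy unfolding pq val_def agree_def by (cases b; cases c) (simp, argo?)+
    qed
  qed
  have xJ: "(Inr False, d) \<in> J" "(Inr True, d) \<in> J" if "d \<in> D" for d using that by (auto simp: J_def)
  have "val x y (Inr False, 0) \<le> s" "s \<le> val x y (Inr True, 0)" using s by (simp_all add: val_def)
  from interleave[OF \<open>finite J\<close> ag xJ(1)[OF D(1)] xJ(2)[OF D(1)] this]
  obtain i j where ij: "i \<in> J" "j \<in> J" and
    m: "\<And>m. m \<in> J \<Longrightarrow> agree s (val x y m) ((val x' y' i + val x' y' j) / 2) (val x' y' m)" by blast
  define s' where "s' = (val x' y' i + val x' y' j) / 2"
  have K: "val x' y' i \<in> K" if "i \<in> J" for i
    using that unfolding K_def J_def val_def by (auto split: if_splits) blast+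
  have sx: "agree s (x + d) s' (x' + d)" and sy: "agree s (y + d) s' (y' + d)" if "d \<in> D" for d
    using m[OF xJ(1)[OF that]] m[OF xJ(2)[OF that]] by (simp_all add: val_def s'_def)
  have sb: "agree s (b + d) s' (b + d)" if "b \<in> B" "d \<in> D" for b d
    using m[of "(Inl b, d)"] that by (simp add: val_def s'_def J_def)
  have "D \<subseteq> sumset D" using D(1) unfolding sumset_def by force
  with st have st': "same_type B D x y x' y'" by (rule same_type_mono)
  have "same_type B D x s x' s'" using st' sx sb unfolding same_type_def by blast
  moreover have "same_type B D s y s' y'"
  proof -
    \<comment> \<open>Comparing y with s + d is comparing s with y - d, and - d is again an
      offset.\<close>
    have "agree y (s + d) y' (s' + d)" if "d \<in> D" for d
      using sy[OF bspec[OF D(2) that]] unfolding agree_def by argo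
    then show ?thesis using st' sb unfolding same_type_def by blast
  qed
  moreover have "x' \<le> s'" "s' \<le> y'" using sx[OF D(1)] sy[OF D(1)] s unfolding agree_def by auto
  ultimately show ?thesis using K[OF ij(1)] K[OF ij(2)] unfolding s'_def by blast
qed

section \<open>Offsets of a formula\<close>

lemma quad_val_comb [simp]: "quad_val (quad_comb k p q) t = (quad_val p t + quad_val q t) * k"
  by (cases p; cases q) (simp add: algebra_simps)

lemma set_pairs: "set (pairs k xs ys) = (\<Union>x\<in>set xs. quad_comb k x ` set ys)"
  by (induction xs) simp_all

text \<open>Offsets are constants, written as polynomials so that \<open>pairs\<close> can add them
  to moving ends.\<close>

definition offset_vals :: "real \<Rightarrow> mlsl \<Rightarrow> real set" where
  "offset_vals t \<phi> = (\<lambda>p. quad_val p t) ` set (offsets \<phi>)"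

lemma offset_vals_simps:
  "offset_vals t (LenEq q) = {0, of_rat q, - of_rat q}"
  "offset_vals t (Neg \<phi>) = offset_vals t \<phi>"
  "offset_vals t (Conj \<phi> \<psi>) = offset_vals t \<phi> \<union> offset_vals t \<psi>"
  "offset_vals t (Ex c \<phi>) = offset_vals t \<phi>"
  "offset_vals t (VChop \<phi> \<psi>) = offset_vals t \<phi> \<union> offset_vals t \<psi>"
  "offset_vals t (HChop \<phi> \<psi>) = sumset (offset_vals t \<phi> \<union> offset_vals t \<psi>)"
proof -
  have "(\<lambda>p. quad_val p t) ` set (pairs 1 xs xs) = sumset ((\<lambda>p. quad_val p t) ` set xs)" for xs
    unfolding set_pairs sumset_def image_UN image_image quad_val_comb mult_1_right by blast
  then show "offset_vals t (HChop \<phi> \<psi>) = sumset (offset_vals t \<phi> \<union> offset_vals t \<psi>)"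
    by (simp add: offset_vals_def image_Un)
qed (auto simp: offset_vals_def image_Un)

lemma finite_offset_vals: "finite (offset_vals t \<phi>)"
  by (simp add: offset_vals_def)

lemma zero_in_sumset: "0 \<in> D \<Longrightarrow> 0 \<in> sumset D"
  unfolding sumset_def by force

lemma zero_in_offset_vals: "0 \<in> offset_vals t \<phi>"
  by (induction \<phi>) (simp_all add: offset_vals_simps zero_in_sumset, simp_all add: offset_vals_def)

lemma uminus_in_offset_vals: "d \<in> offset_vals t \<phi> \<Longrightarrow> - d \<in> offset_vals t \<phi>"
proof (induction \<phi> arbitrary: d)
  case (HChop \<phi> \<psi>)
  then obtain a b where "d = a + b" "a \<in> offset_vals t \<phi> \<union> offset_vals t \<psi>"
    "b \<in> offset_vals t \<phi> \<union> offset_vals t \<psi>" by (auto simp: offset_vals_simps sumset_def)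
  moreover from this HChop.IH have "- a \<in> offset_vals t \<phi> \<union> offset_vals t \<psi>"
    "- b \<in> offset_vals t \<phi> \<union> offset_vals t \<psi>" by blast+
  moreover have "- d = - a + - b" using \<open>d = a + b\<close> by simp
  ultimately show ?case unfolding offset_vals_simps sumset_def by blast
qed (auto simp: offset_vals_simps, auto simp: offset_vals_def)

section \<open>Satisfaction depends only on the type of the interval\<close>

definition car_ends :: "car set \<Rightarrow> snapshot \<Rightarrow> real set" where
  "car_ends I TS = pos TS ` I \<union> (\<lambda>C. pos TS C + len TS C) ` I"

abbreviation view_of :: "lane \<Rightarrow> lane \<Rightarrow> real \<Rightarrow> real \<Rightarrow> car \<Rightarrow> view" where
  "view_of l n x y E \<equiv> \<lparr>lane_lo = l, lane_hi = n, ext_lo = x, ext_hi = y, owner = E\<rparr>"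

lemma interval_disjoint_iff:
  fixes p e x y :: real
  assumes "p \<le> e" "x < y"
  shows "{p..e} \<inter> {x<..<y} = {} \<longleftrightarrow> \<not> (p < y \<and> x < e)"
proof
  assume *: "{p..e} \<inter> {x<..<y} = {}"
  show "\<not> (p < y \<and> x < e)"
  proof
    assume "p < y \<and> x < e"
    \<comment> \<open>The midpoint of x and min y e lies strictly inside the view and below e;
      raising it to p if necessary keeps it below y and at most e.\<close>
    then have "max p ((x + min y e) / 2) \<in> {p..e} \<inter> {x<..<y}"
      using assms by (auto simp: max_def min_def)
    with * show False by blast
  qed
qed auto

text \<open>Positive lengths make each reservation a nonempty interval, so disjointness turns into
  two comparisons of ends, the only kind of fact that types and \<open>qvacant\<close>
  express.\<close>

lemma sat_Free_iff:
  assumes "\<forall>C\<in>I. 0 < len TS C"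
  shows "sat I (TS, view_of l n x y E, \<nu>) Free \<longleftrightarrow> l = n \<and> x < y \<and>
     (\<forall>C\<in>I. l \<in> res TS C \<union> clm TS C \<longrightarrow> \<not> (pos TS C < y \<and> x < pos TS C + len TS C))"
proof (cases "x < y")
  case True
  have "{pos TS C..pos TS C + len TS C} \<inter> {x<..<y} = {} \<longleftrightarrow>
      \<not> (pos TS C < y \<and> x < pos TS C + len TS C)" if "C \<in> I" for C
    using bspec[OF assms that] True by (intro interval_disjoint_iff) auto
  with True show ?thesis unfolding sat.simps view.select_convs by blast
qed simp

text \<open>The spatial atoms compare borders with ends at offset 0, and \<open>LenEq\<close>
  compares the length with its own constant. For a horizontal chop the hypothesis speaks of sums of
  offsets, so \<open>chop_point_transfer\<close> supplies a matching chop point whose two parts have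
  the types required by the induction hypotheses. One direction suffices, as types are
  symmetric.\<close>

lemma sat_same_type:
  assumes fin: "finite I" and len: "\<forall>C\<in>I. 0 < len TS C"
  shows "same_type (car_ends I TS) (offset_vals t \<phi>) x y x' y' \<Longrightarrow> range \<nu> \<subseteq> I \<Longrightarrow>
    sat I (TS, view_of l n x y E, \<nu>) \<phi> \<longleftrightarrow> sat I (TS, view_of l n x' y' E, \<nu>) \<phi>"
proof (induction \<phi> arbitrary: l n x y x' y' \<nu>)
  case Free
  have "agree y (x + 0) y' (x' + 0)" "\<forall>b\<in>car_ends I TS. agree x (b + 0) x' (b + 0) \<and> agree y (b + 0) y' (b + 0)"
    using Free.prems(1) zero_in_offset_vals unfolding same_type_def by blast+
  then show ?case unfolding sat_Free_iff[OF len] by (auto simp: agree_def car_ends_def)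
next
  case (Re c)
  have "agree y (x + 0) y' (x' + 0)" "\<forall>b\<in>car_ends I TS. agree x (b + 0) x' (b + 0) \<and> agree y (b + 0) y' (b + 0)"
    using Re.prems(1) zero_in_offset_vals unfolding same_type_def by blast+
  moreover have "pos TS (\<nu> c) \<in> car_ends I TS" "pos TS (\<nu> c) + len TS (\<nu> c) \<in> car_ends I TS"
    using Re.prems(2) by (auto simp: car_ends_def)
  ultimately show ?case by (auto simp: agree_def not_less[symmetric])
next
  case (Cl c)
  have "agree y (x + 0) y' (x' + 0)" "\<forall>b\<in>car_ends I TS. agree x (b + 0) x' (b + 0) \<and> agree y (b + 0) y' (b + 0)"
    using Cl.prems(1) zero_in_offset_vals unfolding same_type_def by blast+
  moreover have "pos TS (\<nu> c) \<in> car_ends I TS" "pos TS (\<nu> c) + len TS (\<nu> c) \<in> car_ends I TS"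
    using Cl.prems(2) by (auto simp: car_ends_def)
  ultimately show ?case by (auto simp: agree_def not_less[symmetric])
next
  case (LenEq q)
  then have "agree y (x + of_rat q) y' (x' + of_rat q)"
    unfolding same_type_def offset_vals_simps by blast
  then show ?case unfolding sat.simps agree_def by (simp, argo)
next
  case (Ex c \<phi>)
  have "range (\<nu>(CVar c := C)) \<subseteq> I" if "C \<in> I" for C using Ex.prems(2) that by auto
  with Ex show ?case by (auto simp: offset_vals_simps simp del: fun_upd_apply)
next
  case (Conj \<phi> \<psi>)
  then have "same_type (car_ends I TS) (offset_vals t \<phi>) x y x' y'"
    "same_type (car_ends I TS) (offset_vals t \<psi>) x y x' y'"
    by (auto simp: offset_vals_simps elim: same_type_mono)
  from Conj.IH(1)[OF this(1) Conj.prems(2)] Conj.IH(2)[OF this(2) Conj.prems(2)]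
  show ?case by simp
next
  case (VChop \<psi> \<phi>)
  then have "same_type (car_ends I TS) (offset_vals t \<phi>) x y x' y'"
    "same_type (car_ends I TS) (offset_vals t \<psi>) x y x' y'"
    by (auto simp: offset_vals_simps elim: same_type_mono)
  from VChop.IH(1)[OF this(2) VChop.prems(2)] VChop.IH(2)[OF this(1) VChop.prems(2)]
  show ?case by simp
next
  case (HChop \<phi> \<psi>)
  let ?D = "offset_vals t \<phi> \<union> offset_vals t \<psi>"
  have finB: "finite (car_ends I TS)" using fin by (simp add: car_ends_def)
  have D: "finite ?D" "0 \<in> ?D" "\<forall>d\<in>?D. - d \<in> ?D"
    using finite_offset_vals zero_in_offset_vals uminus_in_offset_vals by auto
  have *: "sat I (TS, view_of l n u' v' E, \<nu>) (HChop \<phi> \<psi>)"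
    if st: "same_type (car_ends I TS) (sumset ?D) u v u' v'" and sat: "sat I (TS, view_of l n u v E, \<nu>) (HChop \<phi> \<psi>)"
    for u v u' v'
  proof -
    from sat obtain s where s: "u \<le> s" "s \<le> v" "sat I (TS, view_of l n u s E, \<nu>) \<phi>"
      "sat I (TS, view_of l n s v E, \<nu>) \<psi>"
      unfolding sat.simps by auto
    obtain s' where s': "u' \<le> s'" "s' \<le> v'"
      "same_type (car_ends I TS) ?D u s u' s'" "same_type (car_ends I TS) ?D s v s' v'"
      using chop_point_transfer[OF finB D st s(1,2)] by blast
    have "sat I (TS, view_of l n u' s' E, \<nu>) \<phi>"
      using HChop.IH(1)[OF same_type_mono[OF s'(3)] HChop.prems(2)] s(3) by blast
    moreover have "sat I (TS, view_of l n s' v' E, \<nu>) \<psi>"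
      using HChop.IH(2)[OF same_type_mono[OF s'(4)] HChop.prems(2)] s(4) by blast
    ultimately show ?thesis using s'(1,2) by auto
  qed
  show ?case using *[of x y x' y'] *[of x' y' x y] HChop.prems(1) same_type_sym
    unfolding offset_vals_simps by blast
qed (auto simp: offset_vals_simps)

section \<open>Meaning of the translated formula\<close>

lemma holds_qless [simp]: "holds (qless p q) t \<longleftrightarrow> quad_val p t < quad_val q t"
  by (cases p; cases q) (auto simp: algebra_simps)

lemma holds_connectives [simp]:
  "holds (qle p q) t \<longleftrightarrow> quad_val p t \<le> quad_val q t"
  "holds qtrue t" "\<not> holds qfalse t"
  "holds (qor \<alpha> \<beta>) t \<longleftrightarrow> holds \<alpha> t \<or> holds \<beta> t"
  by (auto simp: qle_def qtrue_def qfalse_def qor_def)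

lemma holds_qdisj [simp]: "holds (qdisj \<alpha>s) t \<longleftrightarrow> (\<exists>\<alpha>\<in>set \<alpha>s. holds \<alpha> t)"
  by (induction \<alpha>s) auto

lemma holds_qvacant [simp]:
  "holds (qvacant G l lo hi) t \<longleftrightarrow> (\<forall>s\<in>set G. l \<in> set (reserved s) \<union> set (claimed s) \<longrightarrow>
     \<not> (quad_val (rear s) t < quad_val hi t \<and> quad_val lo t < quad_val (front s) t))"
  by (induction G) auto

lemma holds_qcover [simp]:
  "holds (qcover l n s ls lo hi) t \<longleftrightarrow> l = n \<and> l \<in> set ls \<and> quad_val lo t < quad_val hi t \<and>
     quad_val (rear s) t \<le> quad_val lo t \<and> quad_val hi t \<le> quad_val (front s) t"
  by (auto simp: qcover_def)

definition represents :: "shape list \<Rightarrow> real \<Rightarrow> car set \<Rightarrow> snapshot \<Rightarrow> bool" where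
  "represents G t I TS \<longleftrightarrow> car_id ` set G = I \<and>
     (\<forall>s\<in>set G. quad_val (rear s) t = pos TS (car_id s) \<and>
        quad_val (front s) t = pos TS (car_id s) + len TS (car_id s) \<and>
        set (reserved s) = res TS (car_id s) \<and> set (claimed s) = clm TS (car_id s))"

lemma find_shape_in: "C \<in> car_id ` set G \<Longrightarrow> find_shape G C \<in> set G \<and> car_id (find_shape G C) = C"
  by (induction G) auto

lemma set_ends: "set (ends G) = rear ` set G \<union> front ` set G"
  by (induction G) auto

lemma holds_qe:
  assumes rep: "represents G t I TS" and len: "\<forall>C\<in>I. 0 < len TS C"
  shows "range \<nu> \<subseteq> I \<Longrightarrow> (\<And>c. c \<in> set (mlsl_vars \<phi>) \<Longrightarrow> lookup N c = \<nu> c) \<Longrightarrow>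
    holds (qe G \<phi> N l n lo hi) t \<longleftrightarrow>
    sat I (TS, view_of l n (quad_val lo t) (quad_val hi t) E, \<nu>) \<phi>"
proof (induction \<phi> arbitrary: N l n lo hi \<nu>)
  case Free
  show ?case unfolding sat_Free_iff[OF len] using rep by (auto simp: represents_def)
next
  case (Re c)
  then have "\<nu> c \<in> car_id ` set G" using rep by (auto simp: represents_def)
  with find_shape_in rep show ?case using Re(2)[of c] by (auto simp: represents_def Let_def)
next
  case (Cl c)
  then have "\<nu> c \<in> car_id ` set G" using rep by (auto simp: represents_def)
  with find_shape_in rep show ?case using Cl(2)[of c] by (auto simp: represents_def Let_def)
next
  case (Ex c \<phi>)
  have "holds (qe G \<phi> ((CVar c, C) # N) l n lo hi) t \<longleftrightarrow>
      sat I (TS, view_of l n (quad_val lo t) (quad_val hi t) E, \<nu>(CVar c := C)) \<phi>" if "C \<in> I" for C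
  proof (rule Ex.IH)
    show "range (\<nu>(CVar c := C)) \<subseteq> I" using Ex.prems(1) that by auto
    show "lookup ((CVar c, C) # N) d = (\<nu>(CVar c := C)) d" if "d \<in> set (mlsl_vars \<phi>)" for d
      using Ex.prems(2)[of d] that by simp
  qed
  moreover have "I = car_id ` set G" using rep by (auto simp: represents_def)
  ultimately show ?case by (auto simp del: fun_upd_apply)
next
  case (LenEq q)
  show ?case by (simp add: Let_def) argo
next
  case (HChop \<phi> \<psi>)
  let ?D = "offset_vals t \<phi> \<union> offset_vals t \<psi>" and ?T = "chop_points G \<phi> \<psi> lo hi"
  let ?B = "car_ends I TS" and ?x = "quad_val lo t" and ?y = "quad_val hi t"
  have fin: "finite I" using rep by (auto simp: represents_def)
  have finB: "finite ?B" using fin by (simp add: car_ends_def)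
  have D: "finite ?D" "0 \<in> ?D" "\<forall>d\<in>?D. - d \<in> ?D"
    using finite_offset_vals zero_in_offset_vals uminus_in_offset_vals by auto
  have IH: "holds (qe G \<phi> N l n lo s) t \<longleftrightarrow> sat I (TS, view_of l n ?x (quad_val s t) E, \<nu>) \<phi>"
    "holds (qe G \<psi> N l n s hi) t \<longleftrightarrow> sat I (TS, view_of l n (quad_val s t) ?y E, \<nu>) \<psi>" for s
    using HChop by auto
  have B: "?B = (\<lambda>p. quad_val p t) ` set (ends G)"
    using rep by (auto simp: represents_def car_ends_def set_ends image_Un image_image)
  have T: "\<exists>p\<in>set ?T. quad_val p t = (k1 + k2) / 2"
    if "k1 \<in> {z + d |z d. z \<in> ?B \<union> {?x, ?y} \<and> d \<in> ?D}" "k2 \<in> {z + d |z d. z \<in> ?B \<union> {?x, ?y} \<and> d \<in> ?D}" for k1 k2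
  proof -
    let ?K = "pairs 1 (lo # hi # ends G) (offsets \<phi> @ offsets \<psi>)"
    have "\<exists>p\<in>set ?K. quad_val p t = k" if "k \<in> {z + d |z d. z \<in> ?B \<union> {?x, ?y} \<and> d \<in> ?D}" for k
    proof -
      from that obtain z d where zd: "k = z + d" "z \<in> (\<lambda>p. quad_val p t) ` set (lo # hi # ends G)"
        "d \<in> (\<lambda>p. quad_val p t) ` set (offsets \<phi> @ offsets \<psi>)"
        unfolding B offset_vals_def by auto
      then obtain p q where pq: "z = quad_val p t" "p \<in> set (lo # hi # ends G)" "d = quad_val q t"
        "q \<in> set (offsets \<phi> @ offsets \<psi>)" by blast
      then have "quad_comb 1 p q \<in> set ?K" unfolding set_pairs by blast
      moreover have "quad_val (quad_comb 1 p q) t = k" using zd pq by simp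
      ultimately show ?thesis by blast
    qed
    with that obtain p q where pq: "p \<in> set ?K" "q \<in> set ?K" "quad_val p t = k1" "quad_val q t = k2"
      by blast
    then have "quad_comb (1/2) p q \<in> set ?T" unfolding chop_points_def Let_def set_pairs[of "1/2"] by blast
    moreover have "quad_val (quad_comb (1/2) p q) t = (k1 + k2) / 2" using pq by simp
    ultimately show ?thesis by blast
  qed
  have "(\<exists>s\<in>set ?T. ?x \<le> quad_val s t \<and> quad_val s t \<le> ?y \<and>
      sat I (TS, view_of l n ?x (quad_val s t) E, \<nu>) \<phi> \<and> sat I (TS, view_of l n (quad_val s t) ?y E, \<nu>) \<psi>)
    \<longleftrightarrow> (\<exists>s\<in>{?x..?y}. sat I (TS, view_of l n ?x s E, \<nu>) \<phi> \<and> sat I (TS, view_of l n s ?y E, \<nu>) \<psi>)"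
    (is "?lhs \<longleftrightarrow> ?rhs")
  proof
    assume ?rhs
    then obtain s where s: "?x \<le> s" "s \<le> ?y" "sat I (TS, view_of l n ?x s E, \<nu>) \<phi>"
      "sat I (TS, view_of l n s ?y E, \<nu>) \<psi>" by auto
    \<comment> \<open>The interval is matched with itself: s is exchanged for a candidate that
      yields parts of the same types, so both subformulas keep their truth values.\<close>
    obtain k1 k2 where k: "k1 \<in> {z + d |z d. z \<in> ?B \<union> {?x, ?y} \<and> d \<in> ?D}"
      "k2 \<in> {z + d |z d. z \<in> ?B \<union> {?x, ?y} \<and> d \<in> ?D}" and s': "?x \<le> (k1 + k2) / 2" "(k1 + k2) / 2 \<le> ?y"
      "same_type ?B ?D ?x s ?x ((k1 + k2) / 2)" "same_type ?B ?D s ?y ((k1 + k2) / 2) ?y"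
      using chop_point_transfer[OF finB D same_type_refl s(1,2)] by blast
    have "sat I (TS, view_of l n ?x ((k1 + k2) / 2) E, \<nu>) \<phi>"
      using sat_same_type[OF fin len same_type_mono[OF s'(3)] HChop.prems(1)] s(3) by blast
    moreover have "sat I (TS, view_of l n ((k1 + k2) / 2) ?y E, \<nu>) \<psi>"
      using sat_same_type[OF fin len same_type_mono[OF s'(4)] HChop.prems(1)] s(4) by blast
    ultimately show ?lhs using T[OF k] s'(1,2) by metis
  qed auto
  with IH show ?case by simp
qed (auto simp: image_iff)

section \<open>Deciding a quantifier-free formula on an interval\<close>

text \<open>If a and b have the same sign, the sign of the sum is clear. If they differ, a and b
  \<open>sqrt D\<close> are compared in absolute value by squaring, which removes the root.\<close>

lemma surd_pos_iff:
  assumes "0 \<le> D"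
  shows "surd_pos a b D \<longleftrightarrow> 0 < a + b * sqrt D"
proof -
  have sq: "(b * sqrt D)^2 = b * b * D" using assms by (simp add: power_mult_distrib power2_eq_square)
  have s: "0 \<le> sqrt D" using assms by simp
  have less: "u^2 < v^2 \<longleftrightarrow> u < v" if "0 \<le> u" "0 \<le> v" for u v :: real
    using that by (meson pos2 power2_less_imp_less power_strict_mono)
  consider "0 < a" "0 \<le> b" | "0 < a" "b < 0" | "a \<le> 0" "0 < b" | "a \<le> 0" "b \<le> 0" by linarith
  then show ?thesis
  proof cases
    case 1
    then have "0 \<le> b * sqrt D" using s by simp
    with 1 show ?thesis by (simp add: surd_pos_def)
  next
    case 2
    have "0 < a + b * sqrt D \<longleftrightarrow> (- (b * sqrt D))^2 < a^2"
      using 2 s by (subst less) (auto simp: mult_nonpos_nonneg)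
    with 2 show ?thesis unfolding power2_minus sq by (simp add: surd_pos_def power2_eq_square)
  next
    case 3
    have "0 < a + b * sqrt D \<longleftrightarrow> (- a)^2 < (b * sqrt D)^2"
      using 3 s by (subst less) auto
    with 3 show ?thesis unfolding power2_minus sq by (simp add: surd_pos_def power2_eq_square)
  next
    case 4
    then have "b * sqrt D \<le> 0" using s by (simp add: mult_nonpos_nonneg)
    with 4 show ?thesis by (simp add: surd_pos_def)
  qed
qed

section \<open>Signs at and just after a sample\<close>

definition sample_val :: "quad \<Rightarrow> real" where
  "sample_val s = (case s of (x, e, D) \<Rightarrow> x + e * sqrt D)"

definition sample_ok :: "quad \<Rightarrow> bool" where
  "sample_ok s \<longleftrightarrow> 0 \<le> snd (snd s)"

lemma pos_at_iff:
  assumes "sample_ok s"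
  shows "pos_at p s \<longleftrightarrow> 0 < quad_val p (sample_val s)"
proof -
  obtain x e D where s: "s = (x, e, D)" by (cases s)
  obtain a b c where p: "p = (a, b, c)" by (cases p)
  have D: "0 \<le> D" using assms by (simp add: s sample_ok_def)
  have "(sqrt D)^2 = D" using D by simp
  then have E: "quad_val p (sample_val s) =
      (a + b * x + c * (x * x + e * e * D)) + (b * e + 2 * c * x * e) * sqrt D"
    unfolding p s sample_val_def by (simp add: algebra_simps power2_eq_square)
  show ?thesis unfolding E unfolding p s pos_at.simps surd_pos_iff[OF D] ..
qed

text \<open>Taylor expansion at r; (b, 2c, 0) is the derivative.\<close>

lemma quad_val_shift:
  "quad_val (a, b, c) (r + h) = quad_val (a, b, c) r + quad_val (b, 2 * c, 0) r * h + c * h^2"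
  by (simp add: algebra_simps power2_eq_square)

lemma eventually_quad_pos:
  assumes "0 < quad_val p r"
  shows "eventually (\<lambda>t. 0 < quad_val p t) (at_right r)"
proof -
  obtain a b c where p: "p = (a, b, c)" by (cases p)
  have "((\<lambda>t. quad_val p t) \<longlongrightarrow> quad_val p r) (at_right r)"
    unfolding p quad_val.simps by (intro tendsto_intros)
  with assms show ?thesis by (intro order_tendstoD(1))
qed

text \<open>At a root the Taylor expansion has the factor t - r, positive on the right, and the
  cofactor tends to the derivative.\<close>

lemma eventually_quad_pos_deriv:
  assumes "0 < quad_val (b, 2 * c, 0) r" "quad_val (a, b, c) r = 0"
  shows "eventually (\<lambda>t. 0 < quad_val (a, b, c) t) (at_right r)"
proof -
  have "((\<lambda>t. quad_val (b, 2 * c, 0) r + c * (t - r)) \<longlongrightarrow> quad_val (b, 2 * c, 0) r + c * (r - r)) (at_right r)"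
    by (intro tendsto_intros)
  with assms(1) have "eventually (\<lambda>t. 0 < quad_val (b, 2 * c, 0) r + c * (t - r)) (at_right r)"
    by (intro order_tendstoD(1)) auto
  moreover have "eventually (\<lambda>t. r < t) (at_right r)" by (simp add: eventually_at_right_less)
  ultimately show ?thesis
  proof eventually_elim
    case (elim t)
    have "quad_val (a, b, c) t = (t - r) * (quad_val (b, 2 * c, 0) r + c * (t - r))"
      using quad_val_shift[of a b c r "t - r"] assms(2) by (simp add: algebra_simps power2_eq_square)
    with elim show ?case by simp
  qed
qed

lemma eventually_not_if_neg:
  assumes "eventually (\<lambda>t. 0 < quad_val (0 - a, 0 - b, 0 - c) t) F"
  shows "eventually (\<lambda>t. \<not> 0 < quad_val (a, b, c) t) F"
  using assms by eventually_elim simp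

text \<open>A nonzero value persists by continuity, and at a root a nonzero derivative decides;
  negative cases are reduced to positive ones by negating the polynomial. If both vanish, the
  polynomial is c (t - r)^2 and has the sign of c.\<close>

lemma eventually_pos_after:
  assumes ok: "sample_ok s"
  shows "eventually (\<lambda>t. 0 < quad_val p t \<longleftrightarrow> pos_after p s) (at_right (sample_val s))"
proof -
  obtain a b c where p: "p = (a, b, c)" by (cases p)
  let ?r = "sample_val s"
  let ?A = "quad_val (a, b, c) ?r" and ?B = "quad_val (b, 2 * c, 0) ?r"
  have neg: "quad_val (0 - a, 0 - b, 0 - c) t = - quad_val (a, b, c) t"
    "quad_val (0 - b, 0 - 2 * c, 0) t = - quad_val (b, 2 * c, 0) t"
    "quad_val (0 - b, 2 * (0 - c), 0) t = - quad_val (b, 2 * c, 0) t" for t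
    by simp_all
  have after: "pos_after p s \<longleftrightarrow> 0 < ?A \<or> \<not> 0 < - ?A \<and> (0 < ?B \<or> \<not> 0 < - ?B \<and> 0 < c)"
    unfolding p pos_after.simps pos_at_iff[OF ok] neg ..
  consider "0 < ?A" | "?A < 0" | "?A = 0" "0 < ?B" | "?A = 0" "?B < 0" | "?A = 0" "?B = 0"
    by linarith
  then show ?thesis
  proof cases
    case 1
    with after eventually_quad_pos[of p ?r] show ?thesis by (simp add: p)
  next
    case 2
    then have "0 < quad_val (0 - a, 0 - b, 0 - c) ?r" unfolding neg by linarith
    then have "eventually (\<lambda>t. \<not> 0 < quad_val (a, b, c) t) (at_right ?r)"
      by (intro eventually_not_if_neg eventually_quad_pos)
    moreover have "\<not> pos_after p s"
      unfolding after using 2 by (simp del: quad_val.simps)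
    ultimately show ?thesis by (simp add: p del: pos_after.simps)
  next
    case 3
    with after eventually_quad_pos_deriv[of b c ?r a] show ?thesis by (simp add: p)
  next
    case 4
    then have "0 < quad_val (0 - b, 2 * (0 - c), 0) ?r" "quad_val (0 - a, 0 - b, 0 - c) ?r = 0"
      unfolding neg by linarith+
    then have "eventually (\<lambda>t. \<not> 0 < quad_val (a, b, c) t) (at_right ?r)"
      by (intro eventually_not_if_neg eventually_quad_pos_deriv)
    moreover have "\<not> pos_after p s"
      unfolding after using 4 by (simp del: quad_val.simps)
    ultimately show ?thesis by (simp add: p del: pos_after.simps)
  next
    case 5
    have "eventually (\<lambda>t. ?r < t) (at_right ?r)" by (simp add: eventually_at_right_less)
    then show ?thesis
    proof eventually_elim
      case (elim t)
      have "quad_val (a, b, c) t = c * (t - ?r)^2"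
        using quad_val_shift[of a b c ?r "t - ?r"] 5 by simp
      with elim after 5 show ?case by (simp add: p zero_less_mult_iff)
    qed
  qed
qed

lemma holds_at_False: "sample_ok s \<Longrightarrow> holds_at False s \<alpha> \<longleftrightarrow> holds \<alpha> (sample_val s)"
  by (induction \<alpha>) (simp_all add: pos_at_iff)

lemma holds_at_True:
  assumes "sample_ok s"
  shows "eventually (\<lambda>t. holds \<alpha> t \<longleftrightarrow> holds_at True s \<alpha>) (at_right (sample_val s))"
proof (induction \<alpha>)
  case (Pos p)
  then show ?case using eventually_pos_after[OF assms] by simp
next
  case (QNot \<alpha>)
  then show ?case by eventually_elim simp
next
  case (QAnd \<alpha> \<beta>)
  then show ?case by eventually_elim simp
qed

section \<open>Roots and intervals of constant sign\<close>

fun qf_polys :: "qf \<Rightarrow> quad set" where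
  "qf_polys (Pos p) = {p}"
| "qf_polys (QNot \<alpha>) = qf_polys \<alpha>"
| "qf_polys (QAnd \<alpha> \<beta>) = qf_polys \<alpha> \<union> qf_polys \<beta>"

lemma finite_qf_polys: "finite (qf_polys \<alpha>)"
  by (induction \<alpha>) auto

lemma holds_cong_polys:
  assumes "\<forall>p\<in>qf_polys \<alpha>. 0 < quad_val p t \<longleftrightarrow> 0 < quad_val p t'"
  shows "holds \<alpha> t \<longleftrightarrow> holds \<alpha> t'"
  using assms by (induction \<alpha>) auto

text \<open>The quadratic formula with its denominator moved under the root, followed by the root of
  the linear case.\<close>

definition root_samples :: "quad \<Rightarrow> quad set" where
  "root_samples p = (case p of (c0, c1, c2) \<Rightarrow>
     {((0 - c1) / (2 * c2), 1, (c1 * c1 - 4 * c0 * c2) / (4 * c2 * c2)),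
      ((0 - c1) / (2 * c2), -1, (c1 * c1 - 4 * c0 * c2) / (4 * c2 * c2)),
      ((0 - c0) / c1, 0, 0)})"

lemma check_roots_iff:
  "check_roots \<alpha> b \<beta> \<longleftrightarrow> (\<forall>p\<in>qf_polys \<beta>. \<forall>s\<in>root_samples p. check_sample \<alpha> b s)"
proof (induction \<beta>)
  case (Pos p)
  then show ?case by (cases p) (simp add: root_samples_def del: check_sample.simps)
qed auto

lemma check_sample_iff:
  "check_sample \<alpha> b s \<longleftrightarrow> (sample_ok s \<and> 0 < sample_val s \<and> sample_val s < b \<longrightarrow>
     holds_at False s \<alpha> \<and> holds_at True s \<alpha>)"
proof -
  obtain x e D where s: "s = (x, e, D)" by (cases s)
  have "pos_at (0, 1, 0) s \<longleftrightarrow> 0 < sample_val s" "pos_at (b, -1, 0) s \<longleftrightarrow> sample_val s < b"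
    if "sample_ok s" using pos_at_iff[OF that] by simp_all
  then show ?thesis unfolding s check_sample.simps unfolding s[symmetric]
    by (auto simp: s sample_ok_def simp del: pos_at.simps)
qed

lemma quad_root_sample:
  assumes "quad_val p r = 0" "p \<noteq> (0, 0, 0)"
  shows "\<exists>s\<in>root_samples p. sample_ok s \<and> sample_val s = r"
proof -
  obtain c0 c1 c2 where p: "p = (c0, c1, c2)" by (cases p)
  have eq: "c0 + c1 * r + c2 * r^2 = 0" using assms(1) by (simp add: p)
  show ?thesis
  proof (cases "c2 = 0")
    case True
    with eq assms(2) have "c1 \<noteq> 0" by (auto simp: p)
    with True eq have "(0 - c0) / c1 = r" by (simp add: field_simps)
    then show ?thesis
      by (intro bexI[of _ "((0 - c0) / c1, 0, 0)"]) (auto simp: root_samples_def p sample_ok_def sample_val_def)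
  next
    case False
    let ?x = "(0 - c1) / (2 * c2)" and ?D = "(c1 * c1 - 4 * c0 * c2) / (4 * c2 * c2)"
    have c0: "c0 = - (c1 * r + c2 * r^2)" using eq by simp
    \<comment> \<open>Eliminating c0 by the root equation makes the radicand a perfect square, so
      its square root is the absolute value of r - x and r is one of the two samples.\<close>
    have D: "?D = (r - ?x)^2" unfolding c0 using False by (simp add: field_simps power2_eq_square)
    show ?thesis
    proof (cases "?x \<le> r")
      case True
      then have "sqrt ?D = r - ?x" unfolding D by simp
      moreover have "0 \<le> ?D" unfolding D by simp
      ultimately show ?thesis
        by (intro bexI[of _ "(?x, 1, ?D)"]) (auto simp: root_samples_def p sample_ok_def sample_val_def)
    next
      case False
      then have "sqrt ?D = - (r - ?x)" unfolding D by (simp only: real_sqrt_abs)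
      moreover have "0 \<le> ?D" unfolding D by simp
      ultimately show ?thesis
        by (intro bexI[of _ "(?x, -1, ?D)"]) (auto simp: root_samples_def p sample_ok_def sample_val_def)
    qed
  qed
qed

lemma finite_quad_roots:
  assumes "p \<noteq> (0, 0, 0)"
  shows "finite {r. quad_val p r = 0}"
proof (rule finite_subset)
  show "{r. quad_val p r = 0} \<subseteq> sample_val ` root_samples p"
    using quad_root_sample[OF _ assms] by force
  show "finite (sample_val ` root_samples p)" by (simp add: root_samples_def split: prod.split)
qed

text \<open>The intermediate value theorem. The left end is excluded because r will itself be a
  root.\<close>

lemma quad_const_sign:
  assumes "r < t'" "t' \<le> t" and nz: "\<And>u. r < u \<Longrightarrow> u \<le> t \<Longrightarrow> quad_val p u \<noteq> 0"
  shows "0 < quad_val p t' \<longleftrightarrow> 0 < quad_val p t"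
proof -
  obtain a b c where p: "p = (a, b, c)" by (cases p)
  have cont: "continuous_on {t'..t} (quad_val p)"
    unfolding p by (simp add: continuous_on_eq_continuous_within) (intro ballI continuous_intros)
  show ?thesis
  proof (rule ccontr)
    assume "\<not> ?thesis"
    then consider "quad_val p t' \<le> 0" "0 \<le> quad_val p t" | "quad_val p t \<le> 0" "0 \<le> quad_val p t'"
      by linarith
    then obtain u where "t' \<le> u" "u \<le> t" "quad_val p u = 0"
      using IVT'[of "quad_val p" t' 0 t, OF _ _ assms(2) cont]
        IVT2'[of "quad_val p" t 0 t', OF _ _ assms(2) cont] by metis
    with nz[of u] assms(1) show False by auto
  qed
qed

text \<open>Every \<open>t\<close> in the interval lies at or just behind the last sample not exceeding it, and no
  polynomial changes its sign in between.\<close>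

lemma check_interval_iff: "check_interval \<alpha> b \<longleftrightarrow> (\<forall>t. 0 \<le> t \<and> t < b \<longrightarrow> holds \<alpha> t)"
proof
  assume L: "check_interval \<alpha> b"
  let ?z = "(0, 0, 0) :: quad"
  have z: "sample_ok ?z" "sample_val ?z = 0" by (simp_all add: sample_ok_def sample_val_def)
  show "\<forall>t. 0 \<le> t \<and> t < b \<longrightarrow> holds \<alpha> t"
  proof (intro allI impI)
    fix t :: real
    assume t: "0 \<le> t \<and> t < b"
    \<comment> \<open>Adding 0 makes the maximum exist; leaving out the zero polynomial, which has
      constant sign anyway, keeps the set finite.\<close>
    let ?R = "{0} \<union> {r. 0 \<le> r \<and> r \<le> t \<and> (\<exists>p\<in>qf_polys \<alpha>. p \<noteq> (0, 0, 0) \<and> quad_val p r = 0)}"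
    have "{r. 0 \<le> r \<and> r \<le> t \<and> (\<exists>p\<in>qf_polys \<alpha>. p \<noteq> (0, 0, 0) \<and> quad_val p r = 0)} \<subseteq>
        (\<Union>p\<in>qf_polys \<alpha> - {(0, 0, 0)}. {r. quad_val p r = 0})" by auto
    moreover have "finite (\<Union>p\<in>qf_polys \<alpha> - {(0, 0, 0)}. {r. quad_val p r = 0})"
      using finite_qf_polys finite_quad_roots by auto
    ultimately have fin: "finite ?R" by (simp add: finite_subset)
    define r where "r = Max ?R"
    have rR: "r \<in> ?R" unfolding r_def using fin by (intro Max_in) auto
    have max: "u \<le> r" if "u \<in> ?R" for u unfolding r_def using fin that by (intro Max_ge) auto
    have r: "0 \<le> r" "r \<le> t" using rR t by auto
    obtain s where s: "sample_ok s" "sample_val s = r" "holds_at False s \<alpha>" "holds_at True s \<alpha>"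
    proof (cases "r = 0")
      case True
      with L t z that[of ?z] show ?thesis unfolding check_interval_def by auto
    next
      case False
      with rR obtain p where p: "p \<in> qf_polys \<alpha>" "p \<noteq> (0, 0, 0)" "quad_val p r = 0" by blast
      from quad_root_sample[OF p(3,2)] obtain s where s: "s \<in> root_samples p" "sample_ok s" "sample_val s = r"
        by blast
      have "check_sample \<alpha> b s"
        using L t p(1) s(1) unfolding check_interval_def check_roots_iff by auto
      with s that[of s] False r t show ?thesis by (auto simp: check_sample_iff)
    qed
    show "holds \<alpha> t"
    proof (cases "t = r")
      case True
      with s holds_at_False show ?thesis by metis
    next
      case False
      with r have "r < t" by simp
      have "eventually (\<lambda>t'. t' < t) (at_right r)" using \<open>r < t\<close> by (rule order_tendstoD(2)[OF tendsto_ident_at])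
      moreover have "eventually (\<lambda>t'. r < t') (at_right r)" by (simp add: eventually_at_right_less)
      moreover have "eventually (\<lambda>t'. holds \<alpha> t') (at_right r)"
        using holds_at_True[OF s(1), of \<alpha>] s by simp
      ultimately have "eventually (\<lambda>t'. t' < t \<and> r < t' \<and> holds \<alpha> t') (at_right r)"
        by eventually_elim simp
      then obtain t' where t': "t' < t" "r < t'" "holds \<alpha> t'"
        using eventually_happens[of _ "at_right r"] trivial_limit_at_right_real[of r] by blast
      have "0 < quad_val p t' \<longleftrightarrow> 0 < quad_val p t" if "p \<in> qf_polys \<alpha>" for p
      proof (cases "p = (0, 0, 0)")
        case False
        show ?thesis
        proof (rule quad_const_sign[OF t'(2)])
          show "t' \<le> t" using t' by simp
          fix u assume u: "r < u" "u \<le> t"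
          show "quad_val p u \<noteq> 0"
          proof
            assume "quad_val p u = 0"
            with that False u r have "u \<in> ?R" by auto
            from max[OF this] u show False by simp
          qed
        qed
      qed simp
      then show ?thesis using holds_cong_polys[of \<alpha> t' t] t'(3) by blast
    qed
  qed
next
  assume R: "\<forall>t. 0 \<le> t \<and> t < b \<longrightarrow> holds \<alpha> t"
  have sample: "holds_at False s \<alpha> \<and> holds_at True s \<alpha>"
    if s: "sample_ok s" "0 \<le> sample_val s" "sample_val s < b" for s
  proof
    show "holds_at False s \<alpha>" using R s holds_at_False by blast
    have "eventually (\<lambda>t. t < b) (at_right (sample_val s))" using s(3) by (rule order_tendstoD(2)[OF tendsto_ident_at])
    moreover have "eventually (\<lambda>t. sample_val s < t) (at_right (sample_val s))"
      by (simp add: eventually_at_right_less)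
    ultimately have "eventually (\<lambda>t. holds_at True s \<alpha>) (at_right (sample_val s))"
      using holds_at_True[OF s(1), of \<alpha>]
    proof eventually_elim
      case (elim t)
      with R s(2) show ?case by auto
    qed
    \<comment> \<open>The eventual statement does not depend on t, and the right neighbourhood
      filter is nontrivial, so it holds outright.\<close>
    then show "holds_at True s \<alpha>"
      using eventually_happens[of _ "at_right (sample_val s)"] trivial_limit_at_right_real[of "sample_val s"]
      by blast
  qed
  then show "check_interval \<alpha> b"
    unfolding check_interval_def check_roots_iff check_sample_iff
    using sample[of "(0, 0, 0)"] by (auto simp: sample_ok_def sample_val_def)
qed

section \<open>Timed words\<close>

definition evolve :: "(car \<Rightarrow> real) \<Rightarrow> real \<Rightarrow> snapshot \<Rightarrow> real \<Rightarrow> snapshot" where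
  "evolve pl b TS z = TS\<lparr>pos := (\<lambda>C. pos TS C + spd TS C * z + 1/2 * acc TS C * z^2),
     spd := (\<lambda>C. spd TS C + acc TS C * z), len := (\<lambda>C. (spd TS C + acc TS C * z)^2 / b + pl C)\<rparr>"

lemma time_trans_iff: "time_trans pl b TS z TS' \<longleftrightarrow> 0 \<le> z \<and> TS' = evolve pl b TS z"
  by (simp add: time_trans_def evolve_def)

fun state_id :: "car_state \<Rightarrow> car" where
  "state_id (CarState C p x y v a R K) = C"

fun state_ok :: "(car \<Rightarrow> real) \<Rightarrow> snapshot \<Rightarrow> car_state \<Rightarrow> bool" where
  "state_ok pl TS (CarState C p x y v a R K) \<longleftrightarrow> p = pl C \<and> x = pos TS C \<and> v = spd TS C \<and>
     a = acc TS C \<and> set R = res TS C \<and> set K = clm TS C"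

text \<open>The stored length is ignored: every delay recomputes it.\<close>

definition represents_state :: "car set \<Rightarrow> (car \<Rightarrow> real) \<Rightarrow> car_state list \<Rightarrow> snapshot \<Rightarrow> bool" where
  "represents_state I pl S TS \<longleftrightarrow> state_id ` set S = I \<and> (\<forall>s\<in>set S. state_ok pl TS s)"

lemma represents_shapes:
  assumes "represents_state I pl S TS"
  shows "represents (map (shape_of b) S) z I (evolve pl b TS z)"
proof -
  have id: "car_id (shape_of b s) = state_id s" for s by (cases s) simp
  have "quad_val (rear (shape_of b s)) z = pos (evolve pl b TS z) (state_id s) \<and>
      quad_val (front (shape_of b s)) z = pos (evolve pl b TS z) (state_id s) + len (evolve pl b TS z) (state_id s) \<and>
      set (reserved (shape_of b s)) = res (evolve pl b TS z) (state_id s) \<and>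
      set (claimed (shape_of b s)) = clm (evolve pl b TS z) (state_id s)"
    if "state_ok pl TS s" for s
    using that
    by (cases s) (simp add: evolve_def power2_eq_square add_divide_distrib algebra_simps)
  with assms show ?thesis
    by (auto simp: represents_def represents_state_def id image_image)
qed

lemma state_id_step [simp]: "state_id (act \<sigma> (advance z s)) = state_id s"
proof (cases s)
  case s: (CarState C p x y v a R K)
  show ?thesis
  proof (cases \<sigma>)
    case (Act b)
    then show ?thesis unfolding s by (cases b) auto
  qed (simp add: s)
qed

lemma state_ok_step:
  assumes "state_ok pl TS s" "symbol_trans (evolve pl b TS z) \<sigma> TS'"
  shows "state_ok pl TS' (act \<sigma> (advance z s))"
proof (cases s)
  case s: (CarState C p x y v a R K)
  show ?thesis
  proof (cases \<sigma>)
    case Dagger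
    with assms show ?thesis by (auto simp: s evolve_def power2_eq_square)
  next
    case (Act b)
    then show ?thesis using assms unfolding s
      by (cases b) (auto simp: evolve_def power2_eq_square)
  qed
qed

lemma represents_state_step:
  assumes "represents_state I pl S TS" "symbol_trans (evolve pl b TS z) \<sigma> TS'"
  shows "represents_state I pl (map (\<lambda>s. act \<sigma> (advance z s)) S) TS'"
  using assms state_ok_step unfolding represents_state_def by (auto simp: image_image)

section \<open>Runs of timed words and their prefixes\<close>

lemma symbol_trans_deterministic: "symbol_trans TS \<sigma> TS1 \<Longrightarrow> symbol_trans TS \<sigma> TS2 \<Longrightarrow> TS1 = TS2"
  by (cases "(TS, \<sigma>, TS1)" rule: symbol_trans.cases) (auto elim!: action_trans.elims)

lemma run_Nil_iff: "run pl b \<tau> TS [] TS' \<longleftrightarrow> TS' = TS"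
  by (auto intro: run_Nil elim: run.cases)

lemma run_Cons_iff:
  "run pl b \<tau> TS ((\<sigma>, \<tau>') # w) TS' \<longleftrightarrow>
     \<tau> \<le> \<tau>' \<and> (\<exists>TS2. symbol_trans (evolve pl b TS (\<tau>' - \<tau>)) \<sigma> TS2 \<and> run pl b \<tau>' TS2 w TS')"
proof
  assume "run pl b \<tau> TS ((\<sigma>, \<tau>') # w) TS'"
  then show "\<tau> \<le> \<tau>' \<and> (\<exists>TS2. symbol_trans (evolve pl b TS (\<tau>' - \<tau>)) \<sigma> TS2 \<and> run pl b \<tau>' TS2 w TS')"
    by (cases rule: run.cases) (auto simp: time_trans_iff)
qed (auto intro!: run_Cons simp: time_trans_iff)

text \<open>With \<open>run_prefix_exists\<close> this makes the definite description in
  \<open>snapshot_at\<close> denote.\<close>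

lemma run_deterministic: "run pl b \<tau> TS w TS1 \<Longrightarrow> run pl b \<tau> TS w TS2 \<Longrightarrow> TS1 = TS2"
proof (induction w arbitrary: \<tau> TS)
  case Nil
  then show ?case by (simp add: run_Nil_iff)
next
  case (Cons x w)
  then show ?case by (cases x) (metis run_Cons_iff symbol_trans_deterministic)
qed

lemma prefix_at_simps:
  "prefix_at [] t = [(Dagger, t)]"
  "prefix_at ((\<sigma>, \<tau>) # w) t = (if \<tau> \<le> t then (\<sigma>, \<tau>) # prefix_at w t else [(Dagger, t)])"
  by (simp_all add: prefix_at_def)

text \<open>The end of the span, extended to an empty remaining word by the time of entry, so that
  an induction over the word can start there.\<close>

fun word_end :: "real \<Rightarrow> timed_word \<Rightarrow> real" where
  "word_end \<tau> [] = \<tau>"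
| "word_end \<tau> (x # w) = word_end (snd x) w"

lemma word_end_last: "w \<noteq> [] \<Longrightarrow> word_end \<tau> w = snd (last w)"
  by (induction w arbitrary: \<tau>) auto

lemma run_le_word_end: "run pl b \<tau> TS w TS' \<Longrightarrow> \<tau> \<le> word_end \<tau> w"
proof (induction w arbitrary: \<tau> TS)
  case (Cons x w)
  then show ?case by (cases x) (fastforce simp: run_Cons_iff)
qed simp

lemma run_prefix_exists:
  "run pl b \<tau> TS w TS' \<Longrightarrow> \<tau> \<le> t \<Longrightarrow> \<exists>TS'. run pl b \<tau> TS (prefix_at w t) TS'"
proof (induction w arbitrary: \<tau> TS)
  case Nil
  then show ?case by (simp add: prefix_at_simps run_Cons_iff run_Nil_iff)
next
  case (Cons x w)
  obtain \<sigma> \<tau>' where x: "x = (\<sigma>, \<tau>')" by fastforce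
  from Cons.prems(1) obtain TS2 where *: "\<tau> \<le> \<tau>'" "symbol_trans (evolve pl b TS (\<tau>' - \<tau>)) \<sigma> TS2"
    "run pl b \<tau>' TS2 w TS'" by (auto simp: x run_Cons_iff)
  show ?case
  proof (cases "\<tau>' \<le> t")
    case True
    with Cons.IH[OF *(3)] * show ?thesis by (auto simp: x prefix_at_simps run_Cons_iff)
  next
    case False
    with Cons.prems(2) show ?thesis by (simp add: x prefix_at_simps run_Cons_iff run_Nil_iff)
  qed
qed

text \<open>For t before \<tau>' the prefix is a single delay, so t corresponds to z = t - \<tau> in
  the current segment. From \<tau>' on, the prefix starts with \<sigma>, whose successor snapshot is
  unique, and the rest is the induction hypothesis.\<close>

lemma solve_iff:
  assumes F: "\<And>S TS z. represents_state I pl S TS \<Longrightarrow> holds (F S) z \<longleftrightarrow> Q (evolve pl b TS z)"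
  shows "run pl b \<tau> TS w TSe \<Longrightarrow> represents_state I pl S TS \<Longrightarrow>
    solve F \<tau> S w \<longleftrightarrow>
      (\<forall>t\<in>{\<tau>..word_end \<tau> w}. \<exists>TS'. run pl b \<tau> TS (prefix_at w t) TS' \<and> Q TS')"
proof (induction w arbitrary: \<tau> TS S)
  case Nil
  have "sample_ok (0, 0, 0)" "sample_val (0, 0, 0) = 0" by (simp_all add: sample_ok_def sample_val_def)
  with holds_at_False[of "(0, 0, 0)"] F[OF Nil.prems(2), of 0] show ?case
    by (simp add: prefix_at_simps run_Cons_iff run_Nil_iff)
next
  case (Cons x w)
  obtain \<sigma> \<tau>' where x: "x = (\<sigma>, \<tau>')" by fastforce
  from Cons.prems(1) obtain TS2 where *: "\<tau> \<le> \<tau>'" "symbol_trans (evolve pl b TS (\<tau>' - \<tau>)) \<sigma> TS2"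
    "run pl b \<tau>' TS2 w TSe" by (auto simp: x run_Cons_iff)
  define G where "G t \<longleftrightarrow> (\<exists>TS'. run pl b \<tau> TS (prefix_at (x # w) t) TS' \<and> Q TS')" for t
  have before: "G t \<longleftrightarrow> holds (F S) (t - \<tau>)" if "\<tau> \<le> t" "t < \<tau>'" for t
  proof -
    have "prefix_at (x # w) t = [(Dagger, t)]" using that(2) by (simp add: x prefix_at_simps)
    moreover have "run pl b \<tau> TS [(Dagger, t)] TS' \<longleftrightarrow> TS' = evolve pl b TS (t - \<tau>)" for TS'
      using that(1) by (simp add: run_Cons_iff run_Nil_iff)
    ultimately show ?thesis unfolding G_def F[OF Cons.prems(2)] by simp
  qed
  have after: "G t \<longleftrightarrow> (\<exists>TS'. run pl b \<tau>' TS2 (prefix_at w t) TS' \<and> Q TS')" if "\<tau>' \<le> t" for t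
  proof -
    have "prefix_at (x # w) t = (\<sigma>, \<tau>') # prefix_at w t" using that by (simp add: x prefix_at_simps)
    moreover have "run pl b \<tau> TS ((\<sigma>, \<tau>') # v) TS' \<longleftrightarrow> run pl b \<tau>' TS2 v TS'" for v TS'
      unfolding run_Cons_iff using *(1,2) symbol_trans_deterministic[OF *(2)] by blast
    ultimately show ?thesis unfolding G_def by simp
  qed
  have "(\<forall>t\<in>{\<tau>..word_end \<tau>' w}. G t) \<longleftrightarrow>
      (\<forall>t. \<tau> \<le> t \<and> t < \<tau>' \<longrightarrow> G t) \<and> (\<forall>t\<in>{\<tau>'..word_end \<tau>' w}. G t)"
    using *(1) run_le_word_end[OF *(3)] by (auto simp: not_less)
  moreover have "(\<forall>t. \<tau> \<le> t \<and> t < \<tau>' \<longrightarrow> G t) \<longleftrightarrow> check_interval (F S) (\<tau>' - \<tau>)"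
  proof -
    have "(\<forall>t. \<tau> \<le> t \<and> t < \<tau>' \<longrightarrow> holds (F S) (t - \<tau>)) \<longleftrightarrow>
        (\<forall>z. 0 \<le> z \<and> z < \<tau>' - \<tau> \<longrightarrow> holds (F S) z)"
    proof (intro iffI allI impI)
      fix z assume all: "\<forall>t. \<tau> \<le> t \<and> t < \<tau>' \<longrightarrow> holds (F S) (t - \<tau>)" and "0 \<le> z \<and> z < \<tau>' - \<tau>"
      then show "holds (F S) z" using all[rule_format, of "\<tau> + z"] by simp
    qed auto
    with before show ?thesis unfolding check_interval_iff by auto
  qed
  moreover have "(\<forall>t\<in>{\<tau>'..word_end \<tau>' w}. G t) \<longleftrightarrow>
      solve F \<tau>' (map (\<lambda>s. act \<sigma> (advance (\<tau>' - \<tau>) s)) S) w"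
    using Cons.IH[OF *(3) represents_state_step[OF Cons.prems(2) *(2)]] after by simp
  ultimately show ?case unfolding G_def[symmetric] by (simp add: x G_def)
qed

lemma holds_segment:
  assumes rep: "represents_state I pl S TS" and pos: "\<forall>C\<in>I. 0 < pl C" "0 < b"
    and val: "range \<nu> \<subseteq> I" "\<forall>c\<in>set (mlsl_vars \<phi>). lookup N c = \<nu> c" and E: "E \<in> I"
  shows "holds (segment b rl rh E l n N \<phi> S) z \<longleftrightarrow> (let TS' = evolve pl b TS z in
     sat I (TS', view_of l n (pos TS' E + rl) (pos TS' E + rh) E, \<nu>) \<phi>)"
proof -
  let ?TS = "evolve pl b TS z" and ?G = "map (shape_of b) S"
  have repG: "represents ?G z I ?TS" using rep by (rule represents_shapes)
  \<comment> \<open>Every delay, even of length 0, recomputes lengths as a square over b plus a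
    positive physical length.\<close>
  have "\<forall>C\<in>I. 0 < len ?TS C" using pos by (simp add: evolve_def add_nonneg_pos)
  note qe = holds_qe[OF repG this val(1), where \<phi> = \<phi> and N = N and E = E, OF bspec[OF val(2)]]
  have "E \<in> car_id ` set ?G" using E repG by (simp add: represents_def)
  from find_shape_in[OF this] repG have "quad_val (rear (find_shape ?G E)) z = pos ?TS E"
    unfolding represents_def by metis
  with qe show ?thesis by (simp add: segment_def Let_def)
qed

lemma decide_iff_holds_globally:
  assumes "admissible p"
  shows "decide p \<longleftrightarrow> holds_globally p"
proof -
  define I TS V \<nu> \<phi> w where "I = cars p" "TS = init_snapshot p" "V = init_view p" "\<nu> = valuation p"
    "\<phi> = formula p" "w = tword p"
  note defs = this
  let ?pl = "plen p" and ?b = "bmax p" and ?E = "owner V" and ?S = "init_states p"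
  from assms have fin: "finite I" and pl: "\<forall>C\<in>I. 0 < ?pl C" "0 < ?b" and
    snap: "is_snapshot I (lanes (lane_count p)) TS" and E: "?E \<in> I" and val: "range \<nu> \<subseteq> I"
    and w: "w \<noteq> []" and "\<exists>TS'. run ?pl ?b 0 TS w TS'"
    by (auto simp: admissible_def Let_def defs is_view_def is_valuation_def is_timed_word_def)
  then obtain TSe where run: "run ?pl ?b 0 TS w TSe" by blast
  \<comment> \<open>\<open>sorted_list_of_set\<close> lists the elements of finite sets only; here
    finiteness comes from the finite set of lanes.\<close>
  have "finite (res TS C)" "finite (clm TS C)" if "C \<in> I" for C
    using snap that finite_subset[of _ "lanes (lane_count p)"] by (auto simp: is_snapshot_def lanes_def)
  with fin have rep: "represents_state I ?pl ?S TS"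
    by (auto simp: represents_state_def init_states_def Let_def defs image_image)
  have r: "fst (rear (find_shape (map (shape_of ?b) ?S) ?E)) = pos TS ?E"
  proof -
    let ?s = "find_shape (map (shape_of ?b) ?S) ?E"
    have "?E \<in> car_id ` set (map (shape_of ?b) ?S)"
      using represents_shapes[OF rep] E by (simp add: represents_def)
    from find_shape_in[OF this] obtain s where s: "s \<in> set ?S" "?s = shape_of ?b s"
      "car_id (shape_of ?b s) = ?E" by auto
    have "state_ok ?pl TS s" using rep s(1) by (simp add: represents_state_def)
    then show ?thesis using s(3) unfolding s(2) by (cases s rule: car_state.exhaust) simp
  qed
  define Q where "Q TS' \<longleftrightarrow> sat I (TS', view_of (lane_lo V) (lane_hi V)
     (pos TS' ?E + (ext_lo V - pos TS ?E)) (pos TS' ?E + (ext_hi V - pos TS ?E)) ?E, \<nu>) \<phi>" for TS'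
  have lookup: "\<forall>c\<in>set (mlsl_vars \<phi>). lookup (init_bindings p) c = \<nu> c"
  proof -
    have "c \<in> set xs \<Longrightarrow> lookup (map (\<lambda>c. (c, \<nu> c)) xs) c = \<nu> c" for xs c by (induction xs) auto
    then show ?thesis by (simp add: init_bindings_def defs)
  qed
  have "decide p \<longleftrightarrow> solve (segment ?b (ext_lo V - pos TS ?E) (ext_hi V - pos TS ?E) ?E (lane_lo V)
      (lane_hi V) (init_bindings p) \<phi>) 0 ?S w"
    using r by (simp add: decide_def Let_def defs)
  also have "\<dots> \<longleftrightarrow> (\<forall>t\<in>{0..word_end 0 w}. \<exists>TS'. run ?pl ?b 0 TS (prefix_at w t) TS' \<and> Q TS')"
  proof (rule solve_iff[OF _ run rep])
    fix S TS1 z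
    assume "represents_state I ?pl S TS1"
    from holds_segment[OF this pl val lookup E] show "holds (segment ?b (ext_lo V - pos TS ?E)
        (ext_hi V - pos TS ?E) ?E (lane_lo V) (lane_hi V) (init_bindings p) \<phi> S) z \<longleftrightarrow>
        Q (evolve ?pl ?b TS1 z)"
      by (simp add: Q_def Let_def)
  qed
  also have "\<dots> \<longleftrightarrow> (\<forall>t\<in>word_span w. sat I (model_at ?pl ?b w (TS, V, \<nu>) t) \<phi>)"
  proof -
    have "(\<exists>TS'. run ?pl ?b 0 TS (prefix_at w t) TS' \<and> Q TS') \<longleftrightarrow>
        sat I (model_at ?pl ?b w (TS, V, \<nu>) t) \<phi>" if t: "0 \<le> t" for t
    proof -
      obtain TS' where TS': "run ?pl ?b 0 TS (prefix_at w t) TS'" using run_prefix_exists[OF run t] ..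
      then have "snapshot_at ?pl ?b w TS t = TS'"
        unfolding snapshot_at_def by (rule the_equality) (rule run_deterministic[OF _ TS'])
      then have "sat I (model_at ?pl ?b w (TS, V, \<nu>) t) \<phi> \<longleftrightarrow> Q TS'"
        by (cases V) (simp add: Q_def Let_def algebra_simps)
      with TS' run_deterministic show ?thesis by blast
    qed
    then show ?thesis using w by (auto simp: word_span_def word_end_last)
  qed
  finally show ?thesis by (simp add: holds_globally_def globally_def defs)
qed

theorem mainTheorem1:
  shows "decidable_on {p. admissible p} problem_data holds_globally"
proof (rule decidable_on_if_computes_real)
  fix p assume "p \<in> {p. admissible p}"
  then show "computes prog (problem_data p) (truth (holds_globally p))"
    using computes_decide[of p] decide_iff_holds_globally[of p] by simp
qed

end
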